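(* Let $G$ be a connected Lie group with Lie algebra $\mathfrak g$. A smooth Hamiltonian $H:T^*G\to\mathbb R$ can be written as $H=h\circ J^L$, where $h:\mathfrak g^*\to\mathbb R$ is a smooth map, if and only if $H$ remains invariant by the action $\widehat\Phi^R$. When the Hamiltonian $H$ comes from a hyperregular smooth Lagrangian $L:TG\to\mathbb R$, $H$ can be written as $H=h\circ J^L$ with $h:\mathfrak g^*\to\mathbb R$ smooth if and only if the Lagrangian $L$ is such that the function $$\overline L=L\circ\varphi:G\times\mathfrak g\to\mathbb R,\quad (x,X)\mapsto\overline L(x,X)=L\bigl(TR_x(X)\bigr)$$ is a function defined on $\mathfrak g$ (i.e. $\overline L(x,X)$ does not depend on $x\in G$), or if and only if $L$ remains invariant by the action $\overline\Phi^R$.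
   Context: $\mathfrak g$ is identified with $T_eG$ and $\mathfrak g^*$ with $T_e^*G$; $\pi_G:T^*G\to G$ is the canonical projection. For $g\in G$, $L_g(x)=gx$ and $R_g(x)=xg$ are the translations of $G$, and $TL_g,TR_g:TG\to TG$ their tangent maps. $\varphi:G\times\mathfrak g\to TG$ is the isomorphism $\varphi(x,X)=TR_x(X)$. The superscript $t$ denotes the transpose: for $\zeta\in T_x^*G$, $(TR_{g^{-1}})^t(\zeta)\in T^*_{xg}G$ is the covector $v\mapsto\langle\zeta,TR_{g^{-1}}(v)\rangle$. The right actions of $G$ on $TG$ and $T^*G$ lifted from right translations are $\overline\Phi^R(v,g)=TR_g(v)$ and $\widehat\Phi^R(\zeta,g)=(TR_{g^{-1}})^t(\zeta)$. $J^L:T^*G\to\mathfrak g^*$ is $J^L(\zeta)=(TR_{\pi_G(\zeta)})^t(\zeta)$, i.e. $\langle J^L(\zeta),X\rangle=\langle\zeta,TR_{\pi_G(\zeta)}(X)\rangle$ (the momentum map of the lift to $T^*G$ of the action of $G$ on itself by left translations). The Legendre map $\mathcal L:TG\to T^*G$ of $L$ sends $v\in T_xG$ to the differential at $v$ of $L|_{T_xG}$. $L$ is hyperregular if $\mathcal L$ is a diffeomorphism of $TG$ onto $T^*G$; the Hamiltonian coming from $L$ is then $H(\xi)=\langle\xi,\mathcal L^{-1}(\xi)\rangle-L(\mathcal L^{-1}(\xi))$, $\xi\in T^*G$. *)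

theory Defs
  imports "HOL-Analysis.Analysis" "HOL-Algebra.Group"
begin

text \<open>
  Intended for open \<open>S\<close> and a finite-dimensional domain, where continuity of all iterated
  directional derivatives is the usual notion of \<open>C\<^sup>k\<close>.
\<close>

primrec Ck_on :: "nat \<Rightarrow> 'a::real_normed_vector set \<Rightarrow> ('a \<Rightarrow> 'b::real_normed_vector) \<Rightarrow> bool" where
  "Ck_on 0 S f \<longleftrightarrow> continuous_on S f"
| "Ck_on (Suc k) S f \<longleftrightarrow>
     (\<forall>x\<in>S. f differentiable (at x)) \<and> (\<forall>v. Ck_on k S (\<lambda>x. frechet_derivative f (at x) v))"

definition smooth_on :: "'a::real_normed_vector set \<Rightarrow> ('a \<Rightarrow> 'b::real_normed_vector) \<Rightarrow> bool" where
  "smooth_on S f \<longleftrightarrow> (\<forall>k. Ck_on k S f)"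

text \<open>
  A chart is a pair \<open>(U, \<phi>)\<close>; the values of \<open>\<phi>\<close> outside \<open>U\<close> are irrelevant.
\<close>

type_synonym ('m, 'e) chart = "'m set \<times> ('m \<Rightarrow> 'e)"

definition chart_inv :: "('m, 'e) chart \<Rightarrow> 'e \<Rightarrow> 'm" where
  "chart_inv c = inv_into (fst c) (snd c)"

definition smooth_atlas :: "'m topology \<Rightarrow> ('m, 'e::real_normed_vector) chart set \<Rightarrow> bool" where
  "smooth_atlas X A \<longleftrightarrow>
     (\<forall>c\<in>A. openin X (fst c) \<and> open (snd c ` fst c) \<and>
        homeomorphic_map (subtopology X (fst c)) (top_of_set (snd c ` fst c)) (snd c)) \<and>
     (\<Union>c\<in>A. fst c) = topspace X \<and>
     (\<forall>c\<in>A. \<forall>d\<in>A. smooth_on (snd c ` (fst c \<inter> fst d)) (snd d \<circ> chart_inv c))"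

definition manifold_of :: "('m, 'e) chart set \<Rightarrow> 'm set" where
  "manifold_of A = (\<Union>c\<in>A. fst c)"

text \<open>
  The requirement that \<open>f\<close> sends a chart neighbourhood of every point into a single chart
  domain makes continuity part of the definition.
\<close>

definition smooth_map ::
  "('m, 'e::real_normed_vector) chart set \<Rightarrow> ('n, 'f::real_normed_vector) chart set
     \<Rightarrow> ('m \<Rightarrow> 'n) \<Rightarrow> bool" where
  "smooth_map A B f \<longleftrightarrow>
     (\<forall>p\<in>manifold_of A. \<exists>c\<in>A. \<exists>d\<in>B. \<exists>W.
        p \<in> fst c \<and> open W \<and> snd c p \<in> W \<and> W \<subseteq> snd c ` fst c \<and>
        f ` (chart_inv c ` W) \<subseteq> fst d \<and> smooth_on W (snd d \<circ> f \<circ> chart_inv c))"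

definition diffeomorphism ::
  "('m, 'e::real_normed_vector) chart set \<Rightarrow> ('n, 'f::real_normed_vector) chart set
     \<Rightarrow> ('m \<Rightarrow> 'n) \<Rightarrow> bool" where
  "diffeomorphism A B f \<longleftrightarrow>
     bij_betw f (manifold_of A) (manifold_of B) \<and>
     smooth_map A B f \<and> smooth_map B A (inv_into (manifold_of A) f)"

definition real_atlas :: "(real, real) chart set" where
  "real_atlas = {(UNIV, id)}"

definition product_atlas ::
  "('m, 'e) chart set \<Rightarrow> ('n, 'f) chart set \<Rightarrow> ('m \<times> 'n, 'e \<times> 'f) chart set" where
  "product_atlas A B = {(fst c \<times> fst d, map_prod (snd c) (snd d)) | c d. c \<in> A \<and> d \<in> B}"

definition chart_at :: "('m, 'e) chart set \<Rightarrow> 'm \<Rightarrow> ('m, 'e) chart" where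
  "chart_at A x = (SOME c. c \<in> A \<and> x \<in> fst c)"

text \<open>
  A tangent vector at \<open>x\<close> is a pair \<open>(x, w)\<close> where \<open>w\<close> gives, for each chart around \<open>x\<close>, the
  components of the vector in that chart, the components in two charts being related by the
  derivative of the coordinate change. For charts not around \<open>x\<close> the entry is fixed to be \<open>0\<close>.
\<close>

type_synonym ('m, 'e) tvec = "'m \<times> (('m, 'e) chart \<Rightarrow> 'e)"

definition tangent_bundle :: "('m, 'e::real_normed_vector) chart set \<Rightarrow> ('m, 'e) tvec set" where
  "tangent_bundle A = {(x, w). x \<in> manifold_of A \<and>
     (\<forall>c. \<not> (c \<in> A \<and> x \<in> fst c) \<longrightarrow> w c = 0) \<and>
     (\<forall>c\<in>A. \<forall>d\<in>A. x \<in> fst c \<inter> fst d \<longrightarrow>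
        w d = frechet_derivative (snd d \<circ> chart_inv c) (at (snd c x)) (w c))}"

definition tangent_space :: "('m, 'e::real_normed_vector) chart set \<Rightarrow> 'm \<Rightarrow> ('m, 'e) tvec set" where
  "tangent_space A x = {v \<in> tangent_bundle A. fst v = x}"

definition tvec_add :: "('m, 'e::real_vector) tvec \<Rightarrow> ('m, 'e) tvec \<Rightarrow> ('m, 'e) tvec" where
  "tvec_add v w = (fst v, \<lambda>c. snd v c + snd w c)"

definition tvec_scale :: "real \<Rightarrow> ('m, 'e::real_vector) tvec \<Rightarrow> ('m, 'e) tvec" where
  "tvec_scale a v = (fst v, \<lambda>c. a *\<^sub>R snd v c)"

text \<open>The vector at \<open>x\<close> whose components in the chart \<open>c\<close> are \<open>u\<close>.\<close>

definition tvec_of ::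
  "('m, 'e::real_normed_vector) chart set \<Rightarrow> ('m, 'e) chart \<Rightarrow> 'm \<Rightarrow> 'e \<Rightarrow> ('m, 'e) tvec" where
  "tvec_of A c x = inv_into (tangent_space A x) (\<lambda>v. snd v c)"

definition tangent_atlas ::
  "('m, 'e::real_normed_vector) chart set \<Rightarrow> (('m, 'e) tvec, 'e \<times> 'e) chart set" where
  "tangent_atlas A =
     {({v \<in> tangent_bundle A. fst v \<in> fst c}, \<lambda>v. (snd c (fst v), snd v c)) | c. c \<in> A}"

text \<open>By the chain rule the result does not depend on the chart chosen around the base point.\<close>

definition tangent_map ::
  "('m, 'e::real_normed_vector) chart set \<Rightarrow> ('n, 'f::real_normed_vector) chart set
     \<Rightarrow> ('m \<Rightarrow> 'n) \<Rightarrow> ('m, 'e) tvec \<Rightarrow> ('n, 'f) tvec" where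
  "tangent_map A B f v = (f (fst v), \<lambda>d.
     if d \<in> B \<and> f (fst v) \<in> fst d
     then let c = chart_at A (fst v)
          in frechet_derivative (snd d \<circ> f \<circ> chart_inv c) (at (snd c (fst v))) (snd v c)
     else 0)"

text \<open>
  A covector at \<open>x\<close> is a pair \<open>(x, l)\<close> with \<open>l\<close> a linear form on the tangent space at \<open>x\<close>
  (extensional, so that equality of covectors is equality of forms). Thus \<open>fst\<close> is the
  canonical projection and the pairing of \<open>\<zeta>\<close> with \<open>v\<close> is \<open>snd \<zeta> v\<close>.
\<close>

type_synonym ('m, 'e) covec = "'m \<times> (('m, 'e) tvec \<Rightarrow> real)"

definition cotangent_space :: "('m, 'e::real_normed_vector) chart set \<Rightarrow> 'm \<Rightarrow> ('m, 'e) covec set" where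
  "cotangent_space A x = {\<zeta>. fst \<zeta> = x \<and> snd \<zeta> \<in> extensional (tangent_space A x) \<and>
     (\<forall>v\<in>tangent_space A x. \<forall>w\<in>tangent_space A x.
        snd \<zeta> (tvec_add v w) = snd \<zeta> v + snd \<zeta> w) \<and>
     (\<forall>a. \<forall>v\<in>tangent_space A x. snd \<zeta> (tvec_scale a v) = a * snd \<zeta> v)}"

definition cotangent_bundle :: "('m, 'e::real_normed_vector) chart set \<Rightarrow> ('m, 'e) covec set" where
  "cotangent_bundle A = (\<Union>x\<in>manifold_of A. cotangent_space A x)"

definition covec_coord ::
  "('m, 'e::real_normed_vector) chart set \<Rightarrow> ('m, 'e) chart \<Rightarrow> ('m, 'e) covec \<Rightarrow> ('e \<Rightarrow>\<^sub>L real)" where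
  "covec_coord A c \<zeta> = Blinfun (\<lambda>u. snd \<zeta> (tvec_of A c (fst \<zeta>) u))"

definition cotangent_atlas ::
  "('m, 'e::real_normed_vector) chart set \<Rightarrow> (('m, 'e) covec, 'e \<times> ('e \<Rightarrow>\<^sub>L real)) chart set" where
  "cotangent_atlas A =
     {({\<zeta> \<in> cotangent_bundle A. fst \<zeta> \<in> fst c}, \<lambda>\<zeta>. (snd c (fst \<zeta>), covec_coord A c \<zeta>))
       | c. c \<in> A}"

text \<open>
  The standard smooth structure of the vector space of covectors at \<open>x\<close>, given by the linear
  isomorphisms onto the dual of the model space induced by the charts around \<open>x\<close>.
\<close>

definition cotangent_space_atlas ::
  "('m, 'e::real_normed_vector) chart set \<Rightarrow> 'm \<Rightarrow> (('m, 'e) covec, 'e \<Rightarrow>\<^sub>L real) chart set" where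
  "cotangent_space_atlas A x =
     {(cotangent_space A x, covec_coord A c) | c. c \<in> A \<and> x \<in> fst c}"

text \<open>The transpose at \<open>x\<close> of the tangent map of \<open>f\<close>, from covectors at \<open>f x\<close> to covectors at \<open>x\<close>.\<close>

definition transpose_map ::
  "('m, 'e::real_normed_vector) chart set \<Rightarrow> ('n, 'f::real_normed_vector) chart set
     \<Rightarrow> ('m \<Rightarrow> 'n) \<Rightarrow> 'm \<Rightarrow> ('n, 'f) covec \<Rightarrow> ('m, 'e) covec" where
  "transpose_map A B f x \<zeta> =
     (x, restrict (\<lambda>v. snd \<zeta> (tangent_map A B f v)) (tangent_space A x))"

text \<open>
  The differential at \<open>v\<close> of the restriction of \<open>L\<close> to the tangent space containing \<open>v\<close>,
  computed in the linear coordinates that a chart induces on this space; any chart around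
  the base point gives the same covector.
\<close>

definition legendre ::
  "('m, 'e::real_normed_vector) chart set \<Rightarrow> (('m, 'e) tvec \<Rightarrow> real)
     \<Rightarrow> ('m, 'e) tvec \<Rightarrow> ('m, 'e) covec" where
  "legendre A L v = (fst v,
     let c = chart_at A (fst v)
     in restrict (\<lambda>w. frechet_derivative (L \<circ> tvec_of A c (fst v)) (at (snd v c)) (snd w c))
          (tangent_space A (fst v)))"

definition hyperregular ::
  "('m, 'e::real_normed_vector) chart set \<Rightarrow> (('m, 'e) tvec \<Rightarrow> real) \<Rightarrow> bool" where
  "hyperregular A L \<longleftrightarrow> diffeomorphism (tangent_atlas A) (cotangent_atlas A) (legendre A L)"

definition hamiltonian_of ::
  "('m, 'e::real_normed_vector) chart set \<Rightarrow> (('m, 'e) tvec \<Rightarrow> real) \<Rightarrow> ('m, 'e) covec \<Rightarrow> real" where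
  "hamiltonian_of A L \<xi> =
     (let v = inv_into (tangent_bundle A) (legendre A L) \<xi> in snd \<xi> v - L v)"

text \<open>
  The model space is an arbitrary finite-dimensional real inner product space; the class
  \<open>euclidean_space\<close> would exclude dimension \<open>0\<close>.
\<close>

locale lie_group = group G for G :: "('g, 'b) monoid_scheme" (structure) +
  fixes X :: "'g topology" and A :: "('g, 'e::real_inner) chart set"
  assumes finite_dim: "\<exists>B::'e set. finite B \<and> span B = UNIV"
    and topspace_eq: "topspace X = carrier G"
    and Hausdorff: "Hausdorff_space X"
    and second_countable: "second_countable X"
    and atlas: "smooth_atlas X A"
    and smooth_mult: "smooth_map (product_atlas A A) A (\<lambda>(x, y). x \<otimes> y)"
    and smooth_inv: "smooth_map A A (\<lambda>x. inv x)"

definition TR ::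
  "('g, 'b) monoid_scheme \<Rightarrow> ('g, 'e::real_normed_vector) chart set \<Rightarrow> 'g
     \<Rightarrow> ('g, 'e) tvec \<Rightarrow> ('g, 'e) tvec" where
  "TR G A g = tangent_map A A (\<lambda>x. x \<otimes>\<^bsub>G\<^esub> g)"

definition right_triv ::
  "('g, 'b) monoid_scheme \<Rightarrow> ('g, 'e::real_normed_vector) chart set
     \<Rightarrow> 'g \<times> ('g, 'e) tvec \<Rightarrow> ('g, 'e) tvec" where
  "right_triv G A = (\<lambda>(x, Y). TR G A x Y)"

definition tangent_right_action ::
  "('g, 'b) monoid_scheme \<Rightarrow> ('g, 'e::real_normed_vector) chart set
     \<Rightarrow> ('g, 'e) tvec \<Rightarrow> 'g \<Rightarrow> ('g, 'e) tvec" where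
  "tangent_right_action G A v g = TR G A g v"

definition cotangent_right_action ::
  "('g, 'b) monoid_scheme \<Rightarrow> ('g, 'e::real_normed_vector) chart set
     \<Rightarrow> ('g, 'e) covec \<Rightarrow> 'g \<Rightarrow> ('g, 'e) covec" where
  "cotangent_right_action G A \<zeta> g =
     transpose_map A A (\<lambda>x. x \<otimes>\<^bsub>G\<^esub> inv\<^bsub>G\<^esub> g) (fst \<zeta> \<otimes>\<^bsub>G\<^esub> g) \<zeta>"

definition lie_algebra_space ::
  "('g, 'b) monoid_scheme \<Rightarrow> ('g, 'e::real_normed_vector) chart set \<Rightarrow> ('g, 'e) tvec set" where
  "lie_algebra_space G A = tangent_space A \<one>\<^bsub>G\<^esub>"

definition left_momentum ::
  "('g, 'b) monoid_scheme \<Rightarrow> ('g, 'e::real_normed_vector) chart set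
     \<Rightarrow> ('g, 'e) covec \<Rightarrow> ('g, 'e) covec" where
  "left_momentum G A \<zeta> = transpose_map A A (\<lambda>x. x \<otimes>\<^bsub>G\<^esub> fst \<zeta>) \<one>\<^bsub>G\<^esub> \<zeta>"

definition factors_through_momentum ::
  "('g, 'b) monoid_scheme \<Rightarrow> ('g, 'e::real_normed_vector) chart set
     \<Rightarrow> (('g, 'e) covec \<Rightarrow> real) \<Rightarrow> bool" where
  "factors_through_momentum G A H \<longleftrightarrow>
     (\<exists>h. smooth_map (cotangent_space_atlas A \<one>\<^bsub>G\<^esub>) real_atlas h \<and>
          (\<forall>\<zeta>\<in>cotangent_bundle A. H \<zeta> = h (left_momentum G A \<zeta>)))"

end

theory Submission
  imports Defs
begin

text \<open>
  A covector \<open>\<zeta>\<close> at \<open>x\<close> satisfies \<open>J\<^sup>L(\<zeta>) = \<zeta> \<cdot> x\<^sup>-\<^sup>1\<close> for the lifted right action, so every orbit meets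
  \<open>T\<^sub>e\<^sup>*G\<close> exactly in the value of \<open>J\<^sup>L\<close>; hence an invariant \<open>H\<close> equals \<open>h \<circ> J\<^sup>L\<close> with \<open>h\<close> the
  restriction of \<open>H\<close> to \<open>T\<^sub>e\<^sup>*G\<close>. For a hyperregular Lagrangian, invariance of \<open>L\<close> makes the Legendre map
  equivariant, which gives invariance of \<open>H\<close>; conversely the fibre derivative of \<open>H\<close> is the inverse
  of the Legendre map, so invariance of \<open>H\<close> makes that inverse equivariant and \<open>L\<close> invariant.
  The same formula for the fibre derivative yields smoothness of \<open>H\<close> along \<open>T\<^sub>e\<^sup>*G\<close>, which is all that
  is needed of \<open>h\<close>, without a chain rule for \<open>C\<^sup>k\<close> maps.
\<close>

section \<open>Smooth functions on normed spaces\<close>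

text \<open>Smoothness arguments stay inside one fibre or one slice, where inclusions are affine and
  coordinate changes linear; the iterated directional derivatives of \<open>Ck_on\<close> behave
  well under exactly these maps. Where nonlinear maps are composed, such as L after the inverse
  Legendre map, only first derivatives are taken, so the ordinary chain rule suffices. Smoothness of
  H along a fibre is then a bootstrap: its derivative is given by the inverse Legendre map, which is
  smooth by hyperregularity. A translation R_g acts from the fibre over x to the fibre over xg by a
  linear map M in coordinates. Differentiating an invariance identity along the fibres therefore
  brings in only M and its transpose: for L this yields equivariance of the Legendre map, for H
  equivariance of its inverse. The values of L return through L(v) = <xi, v> - H(xi), where the
  pairing is preserved because vector and covector move together.\<close>

lemma Ck_on_cong:
  assumes "open S" "\<And>x. x \<in> S \<Longrightarrow> f x = g x" "Ck_on k S f"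
  shows "Ck_on k S g"
  using assms(2,3)
proof (induction k arbitrary: f g)
  case 0
  then show ?case using continuous_on_cong by (metis Ck_on.simps(1))
next
  case (Suc k)
  \<comment> \<open>\<open>frechet_derivative\<close> at x sees a full neighbourhood of x, so
    agreement on \<open>S\<close> passes to derivatives because \<open>S\<close> is open.\<close>
  have *: "(g has_derivative frechet_derivative f (at x)) (at x)" if "x \<in> S" for x
  proof (rule has_derivative_transform_within_open[OF _ assms(1) that])
    show "(f has_derivative frechet_derivative f (at x)) (at x)"
      using Suc.prems(2) that by (simp add: frechet_derivative_works)
  qed (use Suc.prems(1) in auto)
  have eq: "frechet_derivative f (at x) = frechet_derivative g (at x)" if "x \<in> S" for x
    using frechet_derivative_at[OF *[OF that]] .
  have "Ck_on k S (\<lambda>x. frechet_derivative g (at x) v)" for v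
    using Suc.IH[of "\<lambda>x. frechet_derivative f (at x) v" "\<lambda>x. frechet_derivative g (at x) v"]
      eq Suc.prems(2) by auto
  then show ?case using * by (auto simp: differentiable_def)
qed

text \<open>The derivative of x -> f(b + P x) in direction v is the derivative of f in the fixed
  direction P v, again precomposed with the same map. No product appears, so the induction on the
  order closes.\<close>

lemma Ck_on_compose_affine:
  assumes "open S" "bounded_linear P" "Ck_on k S f"
  shows "Ck_on k ((\<lambda>x. b + P x) -` S) (\<lambda>x. f (b + P x))"
  using assms(3)
proof (induction k arbitrary: f)
  case 0
  have "continuous_on UNIV (\<lambda>x. b + P x)"
    using linear_continuous_on[OF assms(2)] by (intro continuous_intros)
  then have "continuous_on ((\<lambda>x. b + P x) -` S) (\<lambda>x. b + P x)"
    by (rule continuous_on_subset) simp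
  then show ?case using 0 by (auto intro: continuous_on_compose2)
next
  case (Suc k)
  let ?S = "(\<lambda>x. b + P x) -` S"
  have "continuous_on UNIV (\<lambda>x. b + P x)"
    using linear_continuous_on[OF assms(2)] by (intro continuous_intros)
  then have op: "open ?S"
    using assms(1) by (rule open_vimage[rotated])
  have *: "((\<lambda>x. f (b + P x)) has_derivative (\<lambda>v. frechet_derivative f (at (b + P x)) (P v))) (at x)"
    if "x \<in> ?S" for x
  proof -
    have "((\<lambda>x. b + P x) has_derivative P) (at x)"
      by (auto intro!: derivative_eq_intros bounded_linear_imp_has_derivative assms(2))
    moreover have "(f has_derivative frechet_derivative f (at (b + P x))) (at (b + P x))"
      using Suc.prems that by (simp add: frechet_derivative_works)
    ultimately show ?thesis
      using diff_chain_at[of "\<lambda>x. b + P x" P x f] by (simp add: o_def)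
  qed
  have "Ck_on k ?S (\<lambda>x. frechet_derivative (\<lambda>x. f (b + P x)) (at x) v)" for v
  proof (rule Ck_on_cong[OF op])
    show "Ck_on k ?S (\<lambda>x. frechet_derivative f (at (b + P x)) (P v))"
      using Suc.IH[of "\<lambda>y. frechet_derivative f (at y) (P v)"] Suc.prems by auto
    show "frechet_derivative f (at (b + P x)) (P v) = frechet_derivative (\<lambda>x. f (b + P x)) (at x) v"
      if "x \<in> ?S" for x
      using fun_cong[OF frechet_derivative_at[OF *[OF that]]] by simp
  qed
  then show ?case using * by (auto simp: differentiable_def)
qed

lemma Ck_on_bounded_linear:
  assumes "open S" "bounded_linear T" "Ck_on k S f"
  shows "Ck_on k S (\<lambda>x. T (f x))"
  using assms(3)
proof (induction k arbitrary: f)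
  case 0
  then show ?case using bounded_linear.continuous_on[OF assms(2)] by simp
next
  case (Suc k)
  have *: "((\<lambda>x. T (f x)) has_derivative (\<lambda>v. T (frechet_derivative f (at x) v))) (at x)"
    if "x \<in> S" for x
    using Suc.prems that
    by (intro bounded_linear.has_derivative[OF assms(2)]) (simp add: frechet_derivative_works)
  have "Ck_on k S (\<lambda>x. frechet_derivative (\<lambda>x. T (f x)) (at x) v)" for v
  proof (rule Ck_on_cong[OF assms(1)])
    show "Ck_on k S (\<lambda>x. T (frechet_derivative f (at x) v))"
      using Suc.IH[of "\<lambda>x. frechet_derivative f (at x) v"] Suc.prems by auto
    show "T (frechet_derivative f (at x) v) = frechet_derivative (\<lambda>x. T (f x)) (at x) v"
      if "x \<in> S" for x
      using fun_cong[OF frechet_derivative_at[OF *[OF that]]] by simp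
  qed
  then show ?case using * by (auto simp: differentiable_def)
qed

lemma smooth_on_cong:
  assumes "open S" "\<And>x. x \<in> S \<Longrightarrow> f x = g x" "smooth_on S f"
  shows "smooth_on S g"
  using assms Ck_on_cong unfolding smooth_on_def by metis

text \<open>The one composition rule for smooth maps on which everything later rests. Inserting a
  fixed base point or a fixed group element into a chart is affine, and changing charts along a
  fixed fibre is linear.\<close>

lemma smooth_on_affine_linear:
  assumes "open S" "bounded_linear P" "bounded_linear T" "smooth_on S f"
  shows "open ((\<lambda>x. b + P x) -` S)" "smooth_on ((\<lambda>x. b + P x) -` S) (\<lambda>x. T (f (b + P x)))"
proof -
  have "continuous_on UNIV (\<lambda>x. b + P x)"
    using linear_continuous_on[OF assms(2)] by (intro continuous_intros)
  then show op: "open ((\<lambda>x. b + P x) -` S)"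
    using assms(1) by (rule open_vimage[rotated])
  show "smooth_on ((\<lambda>x. b + P x) -` S) (\<lambda>x. T (f (b + P x)))"
    using Ck_on_bounded_linear[OF op assms(3)] Ck_on_compose_affine[OF assms(1,2)] assms(4)
    unfolding smooth_on_def by metis
qed

lemma smooth_on_differentiable:
  assumes "smooth_on S f" "x \<in> S"
  shows "f differentiable (at x)"
  using assms unfolding smooth_on_def by (metis Ck_on.simps(2))

text \<open>The model space is only a finitely spanned inner product space, so coordinates come from
  an orthogonal spanning set. Its members need not be unit vectors and one may be 0; division by
  zero then makes the coefficient 0 and the term is harmless.\<close>

lemma linear_imp_bounded_linear:
  fixes T :: "'e::real_inner \<Rightarrow> 'f::real_normed_vector"
  assumes "finite B" "span B = (UNIV :: 'e set)" "linear T"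
  shows "bounded_linear T"
proof -
  obtain C :: "'e set" where C: "finite C" "span C = UNIV" "pairwise orthogonal C"
    using basis_orthogonal[OF assms(1)] assms(2) by auto
  have coord: "x = (\<Sum>c\<in>C. (x \<bullet> c / (c \<bullet> c)) *\<^sub>R c)" for x
  proof -
    \<comment> \<open>The remainder is orthogonal to every element of \<open>C\<close>, hence to the
      span, which is the whole space, hence to itself.\<close>
    let ?y = "x - (\<Sum>c\<in>C. (x \<bullet> c / (c \<bullet> c)) *\<^sub>R c)"
    have "orthogonal ?y b" if "b \<in> C" for b
    proof -
      have "(\<Sum>c\<in>C. (x \<bullet> c / (c \<bullet> c)) * (c \<bullet> b)) = (\<Sum>c\<in>C. if c = b then x \<bullet> b else 0)"
        by (rule sum.cong) (use C(3) that in \<open>auto simp: pairwise_def orthogonal_def\<close>)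
      then show ?thesis
        using that C(1) by (simp add: orthogonal_def inner_diff_left inner_sum_left sum.delta)
    qed
    then have "orthogonal ?y ?y"
      using orthogonal_to_span[of ?y C ?y] C(2) by (auto simp: orthogonal_commute)
    then show ?thesis by (simp add: orthogonal_def)
  qed
  have "norm (T x) \<le> norm x * (\<Sum>c\<in>C. norm c / (c \<bullet> c) * norm (T c))" for x
  proof -
    have "T x = (\<Sum>c\<in>C. (x \<bullet> c / (c \<bullet> c)) *\<^sub>R T c)"
      by (subst coord) (simp add: linear_sum[OF assms(3)] linear_scale[OF assms(3)])
    also have "norm \<dots> \<le> (\<Sum>c\<in>C. norm x * (norm c / (c \<bullet> c) * norm (T c)))"
    proof (rule sum_norm_le)
      fix c
      have "\<bar>x \<bullet> c\<bar> / (c \<bullet> c) \<le> (norm x * norm c) / (c \<bullet> c)"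
        by (rule divide_right_mono) (auto simp: Cauchy_Schwarz_ineq2)
      from mult_right_mono[OF this, of "norm (T c)"]
      show "norm ((x \<bullet> c / (c \<bullet> c)) *\<^sub>R T c) \<le> norm x * (norm c / (c \<bullet> c) * norm (T c))"
        by (simp add: mult.assoc)
    qed
    finally show ?thesis by (simp add: sum_distrib_left)
  qed
  then show ?thesis
    using assms(3) by (auto simp: bounded_linear_def bounded_linear_axioms_def)
qed

section \<open>Maps in charts\<close>

text \<open>The derivative D is an argument, so that derivatives compose without
  \<open>frechet_derivative\<close>. The eventuality clause is there because \<open>snd d\<close> is
  arbitrary outside \<open>fst d\<close>: a derivative in the charts would not force
  \<open>f\<close> to stay in the domain of \<open>d\<close>, and intermediate charts could not be
  cancelled.\<close>

definition chart_deriv ::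
  "('m \<Rightarrow> 'n) \<Rightarrow> ('m, 'e::real_normed_vector) chart \<Rightarrow> ('n, 'f::real_normed_vector) chart
     \<Rightarrow> 'm \<Rightarrow> ('e \<Rightarrow> 'f) \<Rightarrow> bool" where
  "chart_deriv f c d p D \<longleftrightarrow> p \<in> fst c \<and> f p \<in> fst d \<and>
     (\<forall>\<^sub>F y in nhds (snd c p). f (chart_inv c y) \<in> fst d) \<and>
     ((snd d \<circ> f \<circ> chart_inv c) has_derivative D) (at (snd c p))"

lemma chart_inv_chart: "inj_on (snd c) (fst c) \<Longrightarrow> p \<in> fst c \<Longrightarrow> chart_inv c (snd c p) = p"
  by (simp add: chart_inv_def)

lemma has_derivative_nhds_cong:
  assumes "(f has_derivative D) (at x)" "\<forall>\<^sub>F y in nhds x. f y = g y"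
  shows "(g has_derivative D) (at x)"
  using assms has_derivative_transform_within_open[OF assms(1)]
  by (auto simp: eventually_nhds)

lemma chart_deriv_unique:
  "chart_deriv f c d p D \<Longrightarrow> chart_deriv f c d p E \<Longrightarrow> D = E"
  unfolding chart_deriv_def using has_derivative_unique by blast

lemma chart_deriv_frechet:
  "chart_deriv f c d p D \<Longrightarrow> frechet_derivative (snd d \<circ> f \<circ> chart_inv c) (at (snd c p)) = D"
  unfolding chart_deriv_def using frechet_derivative_at by metis

lemma chart_deriv_bounded_linear: "chart_deriv f c d p D \<Longrightarrow> bounded_linear D"
  unfolding chart_deriv_def using has_derivative_bounded_linear by blast

lemma chart_deriv_cong:
  assumes "chart_deriv f c d p D" "open (snd c ` fst c)" "inj_on (snd c) (fst c)"
    and "\<And>q. q \<in> fst c \<Longrightarrow> f q = g q"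
  shows "chart_deriv g c d p D"
proof -
  have p: "p \<in> fst c" using assms(1) by (simp add: chart_deriv_def)
  have ev: "\<forall>\<^sub>F y in nhds (snd c p). y \<in> snd c ` fst c"
    using assms(2) p by (intro eventually_nhds_in_open) auto
  have fg: "\<forall>\<^sub>F y in nhds (snd c p). f (chart_inv c y) = g (chart_inv c y)"
    using ev by eventually_elim (use assms(3,4) in \<open>auto simp: chart_inv_chart\<close>)
  have "\<forall>\<^sub>F y in nhds (snd c p). g (chart_inv c y) \<in> fst d"
    using fg assms(1) unfolding chart_deriv_def
    by (auto elim: eventually_elim2)
  moreover have "((snd d \<circ> g \<circ> chart_inv c) has_derivative D) (at (snd c p))"
    by (rule has_derivative_nhds_cong[of "snd d \<circ> f \<circ> chart_inv c"])
      (use fg assms(1) in \<open>auto simp: chart_deriv_def elim: eventually_mono\<close>)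
  ultimately show ?thesis
    using assms(1) assms(4)[OF p] by (auto simp: chart_deriv_def)
qed

lemma chart_deriv_compose:
  assumes "chart_deriv f c d p D" "chart_deriv g d e (f p) E"
    and "inj_on (snd c) (fst c)" "inj_on (snd d) (fst d)"
  shows "chart_deriv (g \<circ> f) c e p (E \<circ> D)"
proof -
  let ?F = "snd d \<circ> f \<circ> chart_inv c" and ?G = "snd e \<circ> g \<circ> chart_inv d"
  have p: "p \<in> fst c" and Fp: "?F (snd c p) = snd d (f p)"
    using assms(1,3) by (auto simp: chart_deriv_def chart_inv_chart)
  have dF: "(?F has_derivative D) (at (snd c p))"
    using assms(1) by (simp add: chart_deriv_def)
  have dG: "(?G has_derivative E) (at (?F (snd c p)))"
    using assms(2) Fp by (simp add: chart_deriv_def)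
  have ev: "\<forall>\<^sub>F y in nhds (snd c p). f (chart_inv c y) \<in> fst d"
    using assms(1) by (simp add: chart_deriv_def)
  \<comment> \<open>Continuity of \<open>f\<close> in the charts carries the neighbourhood condition
    on \<open>g\<close> at \<open>f p\<close> back to \<open>p\<close>.\<close>
  have "isCont ?F (snd c p)"
    using dF has_derivative_continuous by blast
  then have "(?F \<longlongrightarrow> snd d (f p)) (nhds (snd c p))"
    using Fp by (simp add: isCont_def tendsto_nhds_iff)
  then have "\<forall>\<^sub>F y in nhds (snd c p). g (chart_inv d (?F y)) \<in> fst e"
    using assms(2) unfolding chart_deriv_def by (auto simp: filterlim_iff)
  with ev have "\<forall>\<^sub>F y in nhds (snd c p). (g \<circ> f) (chart_inv c y) \<in> fst e"
    by eventually_elim (use assms(4) in \<open>auto simp: chart_inv_chart\<close>)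
  moreover have "((snd e \<circ> (g \<circ> f) \<circ> chart_inv c) has_derivative (E \<circ> D)) (at (snd c p))"
  proof (rule has_derivative_nhds_cong[OF diff_chain_at[OF dF dG]])
    show "\<forall>\<^sub>F y in nhds (snd c p). (?G \<circ> ?F) y = (snd e \<circ> (g \<circ> f) \<circ> chart_inv c) y"
      using ev by eventually_elim (use assms(4) in \<open>auto simp: chart_inv_chart\<close>)
  qed
  ultimately show ?thesis
    using assms(1,2) by (auto simp: chart_deriv_def)
qed

lemma product_atlasE:
  assumes "C \<in> product_atlas A B" "p \<in> fst C"
  obtains c d where "c \<in> A" "d \<in> B" "C = (fst c \<times> fst d, map_prod (snd c) (snd d))"
    "fst p \<in> fst c" "snd p \<in> fst d"
  using assms unfolding product_atlas_def by (auto simp: mem_Times_iff)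

locale finite_dim_manifold =
  fixes X :: "'m topology" and A :: "('m, 'e::real_inner) chart set"
  assumes fin_dim: "\<exists>B::'e set. finite B \<and> span B = UNIV"
    and smooth_atlas: "smooth_atlas X A"
begin

lemma bounded_linearI: "linear (T :: 'e \<Rightarrow> 'f::real_normed_vector) \<Longrightarrow> bounded_linear T"
  using fin_dim linear_imp_bounded_linear[of _ T] by auto

lemma chart_open: "c \<in> A \<Longrightarrow> open (snd c ` fst c)"
  and chart_openin: "c \<in> A \<Longrightarrow> openin X (fst c)"
  and chart_homeomorphic:
    "c \<in> A \<Longrightarrow> homeomorphic_map (subtopology X (fst c)) (top_of_set (snd c ` fst c)) (snd c)"
  and transition_smooth:
    "c \<in> A \<Longrightarrow> d \<in> A \<Longrightarrow> smooth_on (snd c ` (fst c \<inter> fst d)) (snd d \<circ> chart_inv c)"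
  using smooth_atlas unfolding smooth_atlas_def by simp_all

lemma chart_inj:
  assumes "c \<in> A"
  shows "inj_on (snd c) (fst c)"
proof -
  have "topspace (subtopology X (fst c)) = fst c"
    using openin_subset[OF chart_openin[OF assms]] by auto
  then show ?thesis
    using homeomorphic_imp_injective_map[OF chart_homeomorphic[OF assms]] by simp
qed

lemma chart_image_open:
  assumes "c \<in> A" "openin X U" "U \<subseteq> fst c"
  shows "open (snd c ` U)"
proof -
  have "openin (subtopology X (fst c)) U"
    using openin_subtopology_Int[OF assms(2), of "fst c"] assms(3) by (simp add: inf.absorb1)
  then have "openin (top_of_set (snd c ` fst c)) (snd c ` U)"
    using homeomorphic_imp_open_map[OF chart_homeomorphic[OF assms(1)]] by (simp add: open_map_def)
  then show ?thesis
    using chart_open[OF assms(1)] by (meson openin_open_trans)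
qed

lemma overlap_open: "c \<in> A \<Longrightarrow> d \<in> A \<Longrightarrow> open (snd c ` (fst c \<inter> fst d))"
  by (intro chart_image_open openin_Int chart_openin) auto

lemma manifold_ofI: "c \<in> A \<Longrightarrow> p \<in> fst c \<Longrightarrow> p \<in> manifold_of A"
  by (auto simp: manifold_of_def)

lemma chart_at: "x \<in> manifold_of A \<Longrightarrow> chart_at A x \<in> A \<and> x \<in> fst (chart_at A x)"
  unfolding chart_at_def manifold_of_def by (rule someI_ex) auto

definition transition :: "('m, 'e) chart \<Rightarrow> ('m, 'e) chart \<Rightarrow> 'm \<Rightarrow> 'e \<Rightarrow> 'e" where
  "transition c d p = frechet_derivative (snd d \<circ> chart_inv c) (at (snd c p))"

text \<open>A coordinate change is the identity map seen in two charts. As a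
  \<open>chart_deriv\<close> of \<open>id\<close> it obeys the composition rule; this gives the
  changes of source and target chart and, with uniqueness of derivatives, the cocycle law
  \<open>transition_compose\<close>.\<close>

lemma chart_deriv_transition:
  assumes "c \<in> A" "d \<in> A" "p \<in> fst c" "p \<in> fst d"
  shows "chart_deriv id c d p (transition c d p)"
proof -
  let ?U = "snd c ` (fst c \<inter> fst d)"
  have p: "snd c p \<in> ?U" using assms by auto
  have "\<forall>\<^sub>F y in nhds (snd c p). y \<in> ?U"
    using overlap_open assms p by (intro eventually_nhds_in_open) auto
  then have "\<forall>\<^sub>F y in nhds (snd c p). chart_inv c y \<in> fst d"
    by eventually_elim (use chart_inj[OF assms(1)] in \<open>auto simp: chart_inv_chart\<close>)
  moreover have "(snd d \<circ> chart_inv c) differentiable (at (snd c p))"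
    using smooth_on_differentiable[OF transition_smooth p] assms by blast
  ultimately show ?thesis
    using assms by (simp add: chart_deriv_def transition_def frechet_derivative_works)
qed

lemma chart_deriv_comp:
  assumes "c \<in> A" "d \<in> A" "chart_deriv f c d p D" "chart_deriv g d e (f p) E"
  shows "chart_deriv (g \<circ> f) c e p (E \<circ> D)"
  by (rule chart_deriv_compose[OF assms(3,4) chart_inj[OF assms(1)] chart_inj[OF assms(2)]])

lemma chart_deriv_change_source:
  assumes "c \<in> A" "c' \<in> A" "p \<in> fst c" "chart_deriv f c' d p D"
  shows "chart_deriv f c d p (D \<circ> transition c c' p)"
proof -
  have "chart_deriv id c c' p (transition c c' p)"
    using assms by (intro chart_deriv_transition) (auto simp: chart_deriv_def)
  from chart_deriv_comp[OF assms(1,2) this, of f d D] assms(4) show ?thesis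
    by (simp only: comp_id id_apply)
qed

lemma chart_deriv_change_target:
  assumes "c \<in> A" "d \<in> A" "d' \<in> A" "f p \<in> fst d" "chart_deriv f c d' p D"
  shows "chart_deriv f c d p (transition d' d (f p) \<circ> D)"
proof -
  have "chart_deriv id d' d (f p) (transition d' d (f p))"
    using assms by (intro chart_deriv_transition) (auto simp: chart_deriv_def)
  from chart_deriv_comp[OF assms(1,3,5) this] show ?thesis by (simp only: id_comp)
qed

lemma transition_compose:
  assumes "c \<in> A" "d \<in> A" "e \<in> A" "p \<in> fst c" "p \<in> fst d" "p \<in> fst e"
  shows "transition d e p (transition c d p u) = transition c e p u"
proof -
  have "chart_deriv id c e p (transition d e p \<circ> transition c d p)"
    by (rule chart_deriv_change_source) (use assms in \<open>auto intro: chart_deriv_transition\<close>)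
  from fun_cong[OF chart_deriv_unique[OF this chart_deriv_transition[OF assms(1,3,4,6)]]]
  show ?thesis by simp
qed

lemma transition_self:
  assumes "c \<in> A" "p \<in> fst c"
  shows "transition c c p u = u"
proof -
  have "\<forall>\<^sub>F y in nhds (snd c p). y \<in> snd c ` fst c"
    using chart_open assms by (intro eventually_nhds_in_open) auto
  then have "\<forall>\<^sub>F y in nhds (snd c p). id y = (snd c \<circ> chart_inv c) y"
    by eventually_elim (auto simp: chart_inv_def f_inv_into_f)
  then have "((snd c \<circ> chart_inv c) has_derivative id) (at (snd c p))"
    by (rule has_derivative_nhds_cong[rotated]) (rule has_derivative_id)
  then have "transition c c p = id"
    unfolding transition_def by (rule frechet_derivative_at[symmetric])
  then show ?thesis by simp
qed

lemma bounded_linear_transition: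
  assumes "c \<in> A" "d \<in> A" "p \<in> fst c" "p \<in> fst d"
  shows "bounded_linear (transition c d p)"
  using chart_deriv_transition[OF assms] by (rule chart_deriv_bounded_linear)

subsection \<open>Tangent spaces\<close>

lemma tangent_space_iff:
  "v \<in> tangent_space A x \<longleftrightarrow> fst v = x \<and> x \<in> manifold_of A \<and>
     (\<forall>c. \<not> (c \<in> A \<and> x \<in> fst c) \<longrightarrow> snd v c = 0) \<and>
     (\<forall>c\<in>A. \<forall>d\<in>A. x \<in> fst c \<inter> fst d \<longrightarrow> snd v d = transition c d x (snd v c))"
  by (auto simp: tangent_space_def tangent_bundle_def transition_def split_beta)

lemma tangent_spaceI:
  assumes "fst v = x" "x \<in> manifold_of A"
    and "\<And>c. \<not> (c \<in> A \<and> x \<in> fst c) \<Longrightarrow> snd v c = 0"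
    and "\<And>c d. c \<in> A \<Longrightarrow> d \<in> A \<Longrightarrow> x \<in> fst c \<Longrightarrow> x \<in> fst d \<Longrightarrow>
      snd v d = transition c d x (snd v c)"
  shows "v \<in> tangent_space A x"
  unfolding tangent_space_iff using assms by blast

lemma tangent_bundle_iff: "v \<in> tangent_bundle A \<longleftrightarrow> v \<in> tangent_space A (fst v)"
  by (simp add: tangent_space_def)

lemma tangent_space_fst: "v \<in> tangent_space A x \<Longrightarrow> fst v = x"
  and tangent_space_base: "v \<in> tangent_space A x \<Longrightarrow> x \<in> manifold_of A"
  and tangent_space_bundle: "v \<in> tangent_space A x \<Longrightarrow> v \<in> tangent_bundle A"
  by (auto simp: tangent_space_def tangent_bundle_def)

lemma tangent_space_transition:
  assumes "v \<in> tangent_space A x" "c \<in> A" "d \<in> A" "x \<in> fst c" "x \<in> fst d"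
  shows "snd v d = transition c d x (snd v c)"
  using assms unfolding tangent_space_iff by blast

text \<open>The transition maps fix the components in all other charts around \<open>x\<close>, and
  the remaining entries are 0 by convention. Identities between vectors are therefore checked in one
  convenient chart.\<close>

lemma tangent_space_eqI:
  assumes "v \<in> tangent_space A x" "w \<in> tangent_space A x"
    and "c \<in> A" "x \<in> fst c" "snd v c = snd w c"
  shows "v = w"
proof -
  have "snd v d = snd w d" for d
  proof (cases "d \<in> A \<and> x \<in> fst d")
    case True
    then show ?thesis
      using tangent_space_transition[OF assms(1,3)] tangent_space_transition[OF assms(2,3)] assms(4,5)
      by simp
  next
    case False
    then have "snd v d = 0" "snd w d = 0"
      using assms(1,2) unfolding tangent_space_iff by blast+
    then show ?thesis by simp
  qed
  then show ?thesis
    using assms(1,2) by (auto simp: tangent_space_fst prod_eq_iff)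
qed

lemma tvec_of:
  assumes "c \<in> A" "x \<in> fst c"
  shows "tvec_of A c x u \<in> tangent_space A x" "snd (tvec_of A c x u) c = u"
proof -
  \<comment> \<open>The components \<open>u\<close> are spread to the other charts by the transition
    maps; the cocycle law makes them compatible, and \<open>transition_self\<close> gives back
    \<open>u\<close> at \<open>c\<close>.\<close>
  let ?v = "(x, \<lambda>d. if d \<in> A \<and> x \<in> fst d then transition c d x u else 0)"
  have "?v \<in> tangent_space A x"
    using assms by (auto simp: tangent_space_iff transition_compose manifold_ofI)
  moreover have "snd ?v c = u"
    using assms by (simp add: transition_self)
  ultimately have "u \<in> (\<lambda>v. snd v c) ` tangent_space A x" by force
  then show "tvec_of A c x u \<in> tangent_space A x" "snd (tvec_of A c x u) c = u"
    unfolding tvec_of_def by (auto simp: inv_into_into f_inv_into_f[where f = "\<lambda>v. snd v c"])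
qed

lemma tvec_of_eqI:
  assumes "c \<in> A" "x \<in> fst c" "v \<in> tangent_space A x" "snd v c = u"
  shows "tvec_of A c x u = v"
  by (rule tangent_space_eqI[OF tvec_of(1)[OF assms(1,2)] assms(3,1,2)])
    (simp add: assms(4) tvec_of(2)[OF assms(1,2)])

lemma snd_tvec_add: "snd (tvec_add v w) c = snd v c + snd w c"
  and snd_tvec_scale: "snd (tvec_scale a v) c = a *\<^sub>R snd v c"
  by (simp_all add: tvec_add_def tvec_scale_def)

lemma tvec_add_space:
  assumes "v \<in> tangent_space A x" "w \<in> tangent_space A x"
  shows "tvec_add v w \<in> tangent_space A x"
proof -
  have "snd v d + snd w d = transition c d x (snd v c + snd w c)"
    if "c \<in> A" "d \<in> A" "x \<in> fst c" "x \<in> fst d" for c d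
    unfolding linear_add[OF bounded_linear.linear[OF bounded_linear_transition[OF that]]]
      tangent_space_transition[OF assms(1) that] tangent_space_transition[OF assms(2) that] ..
  moreover have "snd v c + snd w c = 0" if "\<not> (c \<in> A \<and> x \<in> fst c)" for c
    using assms that unfolding tangent_space_iff by (metis add_0)
  ultimately show ?thesis
    using tangent_space_fst[OF assms(1)] tangent_space_base[OF assms(1)]
    unfolding tangent_space_iff tvec_add_def fst_conv snd_conv by blast
qed

lemma tvec_scale_space:
  assumes "v \<in> tangent_space A x"
  shows "tvec_scale a v \<in> tangent_space A x"
proof -
  have "a *\<^sub>R snd v d = transition c d x (a *\<^sub>R snd v c)"
    if "c \<in> A" "d \<in> A" "x \<in> fst c" "x \<in> fst d" for c d
    unfolding linear_scale[OF bounded_linear.linear[OF bounded_linear_transition[OF that]]]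
      tangent_space_transition[OF assms(1) that] ..
  moreover have "a *\<^sub>R snd v c = 0" if "\<not> (c \<in> A \<and> x \<in> fst c)" for c
    using assms that unfolding tangent_space_iff by (metis scaleR_zero_right)
  ultimately show ?thesis
    using tangent_space_fst[OF assms(1)] tangent_space_base[OF assms(1)]
    unfolding tangent_space_iff tvec_scale_def fst_conv snd_conv by blast
qed

lemma tvec_of_add:
  assumes "c \<in> A" "x \<in> fst c"
  shows "tvec_of A c x (u + w) = tvec_add (tvec_of A c x u) (tvec_of A c x w)"
  using assms by (intro tvec_of_eqI tvec_add_space) (auto simp: tvec_of tvec_add_def)

lemma tvec_of_scale:
  assumes "c \<in> A" "x \<in> fst c"
  shows "tvec_of A c x (a *\<^sub>R u) = tvec_scale a (tvec_of A c x u)"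
  using assms by (intro tvec_of_eqI tvec_scale_space) (auto simp: tvec_of tvec_scale_def)

lemma tvec_of_transition:
  assumes "c \<in> A" "d \<in> A" "x \<in> fst c" "x \<in> fst d"
  shows "tvec_of A d x (transition c d x u) = tvec_of A c x u"
  using tvec_of[OF assms(1,3)] tangent_space_transition[OF _ assms(1-4)]
  by (intro tvec_of_eqI assms) auto

subsection \<open>Tangent maps\<close>

text \<open>One pair of charts is enough as a witness: \<open>mdifferentiable_chart_deriv\<close>
  transfers the property to every pair around \<open>p\<close> and \<open>f p\<close>.\<close>

definition mdifferentiable :: "('m \<Rightarrow> 'm) \<Rightarrow> 'm \<Rightarrow> bool" where
  "mdifferentiable f p \<longleftrightarrow> (\<exists>c\<in>A. \<exists>d\<in>A. \<exists>D. chart_deriv f c d p D)"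

lemma mdifferentiable_base:
  "mdifferentiable f p \<Longrightarrow> p \<in> manifold_of A \<and> f p \<in> manifold_of A"
  unfolding mdifferentiable_def chart_deriv_def by (auto intro: manifold_ofI)

lemma mdifferentiable_chart_deriv:
  assumes "mdifferentiable f p" "c \<in> A" "d \<in> A" "p \<in> fst c" "f p \<in> fst d"
  obtains D where "chart_deriv f c d p D"
proof -
  obtain c' d' D where D: "c' \<in> A" "d' \<in> A" "chart_deriv f c' d' p D"
    using assms(1) unfolding mdifferentiable_def by blast
  from chart_deriv_change_target[OF assms(2,3) D(2) assms(5)
      chart_deriv_change_source[OF assms(2) D(1) assms(4) D(3)]]
  show ?thesis by (rule that)
qed

lemma mdifferentiable_compose:
  assumes "mdifferentiable f p" "mdifferentiable g (f p)"
  shows "mdifferentiable (g \<circ> f) p"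
proof -
  obtain c d D where D: "c \<in> A" "d \<in> A" "chart_deriv f c d p D"
    using assms(1) unfolding mdifferentiable_def by blast
  have e: "chart_at A (g (f p)) \<in> A" "g (f p) \<in> fst (chart_at A (g (f p)))"
    using chart_at mdifferentiable_base[OF assms(2)] by auto
  obtain E where "chart_deriv g d (chart_at A (g (f p))) (f p) E"
    using mdifferentiable_chart_deriv[OF assms(2) D(2) e(1) _ e(2)] D(3)
    by (auto simp: chart_deriv_def)
  then show ?thesis
    unfolding mdifferentiable_def using chart_deriv_comp[OF D] D(1) e(1) by blast
qed

text \<open>\<open>tangent_map\<close> computes in the chart picked by \<open>chart_at\<close>; the
  factor \<open>transition ?c c x\<close> turns the components of \<open>v\<close> there into those
  in \<open>c\<close>, which frees the formula from that choice.\<close>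

lemma tangent_map_chart:
  assumes "chart_deriv f c d x D" "c \<in> A" "d \<in> A" "v \<in> tangent_space A x"
  shows "snd (tangent_map A A f v) d = D (snd v c)"
proof -
  let ?c = "chart_at A x"
  have c: "?c \<in> A" "x \<in> fst ?c"
    using chart_at tangent_space_base[OF assms(4)] by auto
  have x: "x \<in> fst c" "f x \<in> fst d"
    using assms(1) by (auto simp: chart_deriv_def)
  have "frechet_derivative (snd d \<circ> f \<circ> chart_inv ?c) (at (snd ?c x)) = D \<circ> transition ?c c x"
    by (rule chart_deriv_frechet[OF chart_deriv_change_source[OF c(1) assms(2) c(2) assms(1)]])
  then show ?thesis
    using assms x tangent_space_transition[OF assms(4) c(1) assms(2) c(2) x(1)]
    by (simp add: tangent_map_def tangent_space_fst Let_def)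
qed

lemma tangent_map_space:
  assumes "mdifferentiable f x" "v \<in> tangent_space A x"
  shows "tangent_map A A f v \<in> tangent_space A (f x)"
proof -
  let ?c = "chart_at A x"
  have c: "?c \<in> A" "x \<in> fst ?c"
    using chart_at tangent_space_base[OF assms(2)] by auto
  have "snd (tangent_map A A f v) e = transition d e (f x) (snd (tangent_map A A f v) d)"
    if de: "d \<in> A" "e \<in> A" "f x \<in> fst d" "f x \<in> fst e" for d e
  proof -
    obtain D where D: "chart_deriv f ?c d x D"
      using mdifferentiable_chart_deriv[OF assms(1) c(1) de(1) c(2) de(3)] .
    show ?thesis
      using tangent_map_chart[OF chart_deriv_change_target[OF c(1) de(2,1,4) D] c(1) de(2) assms(2)]
        tangent_map_chart[OF D c(1) de(1) assms(2)]
      by simp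
  qed
  moreover have "fst (tangent_map A A f v) = f x" "f x \<in> manifold_of A"
    using assms mdifferentiable_base by (auto simp: tangent_map_def tangent_space_fst)
  moreover have "snd (tangent_map A A f v) d = 0" if "\<not> (d \<in> A \<and> f x \<in> fst d)" for d
    using that assms(2) by (auto simp: tangent_map_def tangent_space_fst)
  ultimately show ?thesis by (intro tangent_spaceI)
qed

lemma tangent_map_compose:
  assumes "mdifferentiable f x" "mdifferentiable g (f x)" "v \<in> tangent_space A x"
  shows "tangent_map A A g (tangent_map A A f v) = tangent_map A A (g \<circ> f) v"
proof -
  let ?c = "chart_at A x" and ?d = "chart_at A (f x)" and ?e = "chart_at A (g (f x))"
  have c: "?c \<in> A" "x \<in> fst ?c" "?d \<in> A" "f x \<in> fst ?d" "?e \<in> A" "g (f x) \<in> fst ?e"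
    using chart_at mdifferentiable_base assms by blast+
  obtain D where D: "chart_deriv f ?c ?d x D"
    using mdifferentiable_chart_deriv[OF assms(1)] c by metis
  obtain E where E: "chart_deriv g ?d ?e (f x) E"
    using mdifferentiable_chart_deriv[OF assms(2)] c by metis
  have fv: "tangent_map A A f v \<in> tangent_space A (f x)"
    using tangent_map_space assms by blast
  show ?thesis
  proof (rule tangent_space_eqI)
    show "tangent_map A A g (tangent_map A A f v) \<in> tangent_space A (g (f x))"
      using tangent_map_space assms(2) fv by blast
    show "tangent_map A A (g \<circ> f) v \<in> tangent_space A (g (f x))"
      using tangent_map_space[OF mdifferentiable_compose] assms by fastforce
    show "snd (tangent_map A A g (tangent_map A A f v)) ?e = snd (tangent_map A A (g \<circ> f) v) ?e"
      using tangent_map_chart[OF E c(3,5) fv] tangent_map_chart[OF D c(1,3) assms(3)]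
        tangent_map_chart[OF chart_deriv_comp[OF c(1,3) D E] c(1,5) assms(3)]
      by simp
  qed (use c in auto)
qed

lemma tangent_map_id:
  assumes "v \<in> tangent_space A x"
  shows "tangent_map A A id v = v"
proof (rule tangent_space_eqI)
  let ?c = "chart_at A x"
  have c: "?c \<in> A" "x \<in> fst ?c"
    using chart_at tangent_space_base[OF assms] by auto
  have D: "chart_deriv id ?c ?c x (transition ?c ?c x)"
    using chart_deriv_transition c by blast
  have "mdifferentiable id x"
    using D c unfolding mdifferentiable_def by blast
  from tangent_map_space[OF this assms] show "tangent_map A A id v \<in> tangent_space A x" by simp
  show "snd (tangent_map A A id v) ?c = snd v ?c"
    using tangent_map_chart[OF D c(1,1) assms] c by (simp add: transition_self)
qed (use assms chart_at tangent_space_base in auto)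

lemma mdifferentiable_cong:
  assumes "mdifferentiable f x" "\<And>y. y \<in> manifold_of A \<Longrightarrow> f y = g y"
  shows "mdifferentiable g x"
  using assms chart_deriv_cong chart_open chart_inj manifold_ofI
  unfolding mdifferentiable_def by metis

text \<open>The group laws hold only on the carrier, so a composite of translations agrees with a
  single translation only there. Derivatives still agree because a chart domain gives a whole
  coordinate neighbourhood inside the manifold.\<close>

lemma tangent_map_cong:
  assumes "mdifferentiable f x" "\<And>y. y \<in> manifold_of A \<Longrightarrow> f y = g y" "v \<in> tangent_space A x"
  shows "tangent_map A A f v = tangent_map A A g v"
proof -
  let ?c = "chart_at A x" and ?d = "chart_at A (f x)"
  have c: "?c \<in> A" "x \<in> fst ?c" "?d \<in> A" "f x \<in> fst ?d"
    using chart_at mdifferentiable_base assms by blast+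
  obtain D where D: "chart_deriv f ?c ?d x D"
    using mdifferentiable_chart_deriv[OF assms(1)] c by metis
  have D': "chart_deriv g ?c ?d x D"
    using chart_deriv_cong[OF D chart_open chart_inj] c assms(2) manifold_ofI by blast
  have "g x = f x"
    using assms(2,3) tangent_space_base by simp
  then have "tangent_map A A g v \<in> tangent_space A (f x)"
    using tangent_map_space[OF mdifferentiable_cong[OF assms(1,2)] assms(3)] by simp
  then show ?thesis
    using tangent_space_eqI[OF tangent_map_space[OF assms(1,3)]] c
      tangent_map_chart[OF D c(1,3) assms(3)] tangent_map_chart[OF D' c(1,3) assms(3)]
    by simp
qed

lemma tangent_map_add:
  assumes "mdifferentiable f x" "v \<in> tangent_space A x" "w \<in> tangent_space A x"
  shows "tangent_map A A f (tvec_add v w) = tvec_add (tangent_map A A f v) (tangent_map A A f w)"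
proof -
  let ?c = "chart_at A x" and ?d = "chart_at A (f x)"
  have c: "?c \<in> A" "x \<in> fst ?c" "?d \<in> A" "f x \<in> fst ?d"
    using chart_at mdifferentiable_base assms by blast+
  obtain D where D: "chart_deriv f ?c ?d x D"
    using mdifferentiable_chart_deriv[OF assms(1)] c by metis
  have lin: "linear D"
    using chart_deriv_bounded_linear[OF D] by (rule bounded_linear.linear)
  note * = tangent_map_chart[OF D c(1,3)]
  have "snd (tangent_map A A f (tvec_add v w)) ?d
      = snd (tvec_add (tangent_map A A f v) (tangent_map A A f w)) ?d"
    unfolding *[OF tvec_add_space[OF assms(2,3)]]
    by (simp add: tvec_add_def *[OF assms(2)] *[OF assms(3)] linear_add[OF lin])
  then show ?thesis
    using assms c by (intro tangent_space_eqI[of _ "f x" _ ?d] tvec_add_space tangent_map_space)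
qed

lemma tangent_map_scale:
  assumes "mdifferentiable f x" "v \<in> tangent_space A x"
  shows "tangent_map A A f (tvec_scale a v) = tvec_scale a (tangent_map A A f v)"
proof -
  let ?c = "chart_at A x" and ?d = "chart_at A (f x)"
  have c: "?c \<in> A" "x \<in> fst ?c" "?d \<in> A" "f x \<in> fst ?d"
    using chart_at mdifferentiable_base assms by blast+
  obtain D where D: "chart_deriv f ?c ?d x D"
    using mdifferentiable_chart_deriv[OF assms(1)] c by metis
  have lin: "linear D"
    using chart_deriv_bounded_linear[OF D] by (rule bounded_linear.linear)
  note * = tangent_map_chart[OF D c(1,3)]
  have "snd (tangent_map A A f (tvec_scale a v)) ?d = snd (tvec_scale a (tangent_map A A f v)) ?d"
    unfolding *[OF tvec_scale_space[OF assms(2)]]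
    by (simp add: tvec_scale_def *[OF assms(2)] linear_scale[OF lin])
  then show ?thesis
    using assms c by (intro tangent_space_eqI[of _ "f x" _ ?d] tvec_scale_space tangent_map_space)
qed

lemma smooth_map_mdifferentiable:
  assumes "smooth_map A A f" "p \<in> manifold_of A"
  shows "mdifferentiable f p"
proof -
  obtain c d W where W: "c \<in> A" "d \<in> A" "p \<in> fst c" "open W" "snd c p \<in> W"
    "f ` (chart_inv c ` W) \<subseteq> fst d" "smooth_on W (snd d \<circ> f \<circ> chart_inv c)"
    using assms unfolding smooth_map_def by metis
  have "\<forall>\<^sub>F y in nhds (snd c p). y \<in> W"
    using W by (intro eventually_nhds_in_open)
  then have "\<forall>\<^sub>F y in nhds (snd c p). f (chart_inv c y) \<in> fst d"
    by eventually_elim (use W in blast)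
  moreover have "f p \<in> fst d"
  proof -
    have "f (chart_inv c (snd c p)) \<in> fst d" using W by blast
    then show ?thesis using chart_inv_chart[OF chart_inj] W by simp
  qed
  moreover have "\<exists>D. (snd d \<circ> f \<circ> chart_inv c has_derivative D) (at (snd c p))"
    using smooth_on_differentiable[OF W(7,5)] by (simp add: differentiable_def)
  ultimately show ?thesis
    unfolding mdifferentiable_def chart_deriv_def using W by blast
qed

subsection \<open>Cotangent spaces\<close>

text \<open>Inverse of \<open>covec_coord A c\<close> on the fibre over \<open>x\<close>: it
  parametrises covectors by a normed space, where derivatives make sense. The restriction makes the
  form extensional, as \<open>cotangent_space\<close> demands.\<close>

definition covec_of :: "('m, 'e) chart \<Rightarrow> 'm \<Rightarrow> ('e \<Rightarrow>\<^sub>L real) \<Rightarrow> ('m, 'e) covec" where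
  "covec_of c x l = (x, restrict (\<lambda>w. blinfun_apply l (snd w c)) (tangent_space A x))"

lemma fst_covec_of [simp]: "fst (covec_of c x l) = x"
  by (simp add: covec_of_def)

lemma snd_covec_of: "w \<in> tangent_space A x \<Longrightarrow> snd (covec_of c x l) w = blinfun_apply l (snd w c)"
  by (simp add: covec_of_def)

lemma cotangent_space_fst: "\<zeta> \<in> cotangent_space A x \<Longrightarrow> fst \<zeta> = x"
  by (simp add: cotangent_space_def)

lemma cotangent_bundle_iff:
  "\<zeta> \<in> cotangent_bundle A \<longleftrightarrow> fst \<zeta> \<in> manifold_of A \<and> \<zeta> \<in> cotangent_space A (fst \<zeta>)"
  by (auto simp: cotangent_bundle_def cotangent_space_def)

lemma cotangent_space_eqI:
  assumes "\<zeta> \<in> cotangent_space A x" "\<eta> \<in> cotangent_space A x"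
    and "\<And>v. v \<in> tangent_space A x \<Longrightarrow> snd \<zeta> v = snd \<eta> v"
  shows "\<zeta> = \<eta>"
  using assms extensionalityI[of "snd \<zeta>" "tangent_space A x" "snd \<eta>"]
  by (auto simp: cotangent_space_def prod_eq_iff)

lemma covec_of_space: "covec_of c x l \<in> cotangent_space A x"
proof -
  have "snd (covec_of c x l) (tvec_add v w) = snd (covec_of c x l) v + snd (covec_of c x l) w"
    if "v \<in> tangent_space A x" "w \<in> tangent_space A x" for v w
    using that tvec_add_space[OF that] by (simp add: snd_covec_of snd_tvec_add blinfun.add_right)
  moreover have "snd (covec_of c x l) (tvec_scale a v) = a * snd (covec_of c x l) v"
    if "v \<in> tangent_space A x" for a v
    using that tvec_scale_space[OF that] by (simp add: snd_covec_of snd_tvec_scale blinfun.scaleR_right)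
  moreover have "snd (covec_of c x l) \<in> extensional (tangent_space A x)"
    by (simp add: covec_of_def)
  ultimately show ?thesis
    unfolding cotangent_space_def by simp
qed

text \<open>\<open>Blinfun\<close> returns the intended form only for bounded linear maps; the
  finite dimension of the model space enters here, through \<open>bounded_linearI\<close>.\<close>

lemma covec_coord_apply:
  assumes "c \<in> A" "x \<in> fst c" "\<zeta> \<in> cotangent_space A x"
  shows "blinfun_apply (covec_coord A c \<zeta>) u = snd \<zeta> (tvec_of A c x u)"
proof -
  have "linear (\<lambda>u. snd \<zeta> (tvec_of A c x u))"
    using assms(3) tvec_of[OF assms(1,2)]
    by (intro linearI) (simp_all add: tvec_of_add tvec_of_scale assms cotangent_space_def)
  then show ?thesis
    using assms(3) unfolding covec_coord_def
    by (simp add: cotangent_space_fst bounded_linear_Blinfun_apply bounded_linearI)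
qed

lemma covec_coord_covec_of:
  assumes "c \<in> A" "x \<in> fst c"
  shows "covec_coord A c (covec_of c x l) = l"
  using tvec_of[OF assms]
  by (intro blinfun_eqI) (simp add: covec_coord_apply[OF assms covec_of_space] snd_covec_of)

lemma covec_of_covec_coord:
  assumes "c \<in> A" "x \<in> fst c" "\<zeta> \<in> cotangent_space A x"
  shows "covec_of c x (covec_coord A c \<zeta>) = \<zeta>"
proof (rule cotangent_space_eqI[OF covec_of_space assms(3)])
  fix v assume v: "v \<in> tangent_space A x"
  then have "tvec_of A c x (snd v c) = v"
    using tvec_of_eqI assms by blast
  then show "snd (covec_of c x (covec_coord A c \<zeta>)) v = snd \<zeta> v"
    using v assms by (simp add: covec_coord_apply snd_covec_of)
qed

lemma transpose_map_space:
  assumes "mdifferentiable f x" "\<zeta> \<in> cotangent_space A (f x)"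
  shows "transpose_map A A f x \<zeta> \<in> cotangent_space A x"
  using assms(2)
  by (simp add: cotangent_space_def transpose_map_def tvec_add_space tvec_scale_space
      tangent_map_add[OF assms(1)] tangent_map_scale[OF assms(1)] tangent_map_space[OF assms(1)])

lemma snd_transpose_map:
  "v \<in> tangent_space A x \<Longrightarrow> snd (transpose_map A A f x \<zeta>) v = snd \<zeta> (tangent_map A A f v)"
  by (simp add: transpose_map_def)

subsection \<open>The charts of the tangent and cotangent bundles\<close>

definition tangent_chart :: "('m, 'e) chart \<Rightarrow> (('m, 'e) tvec, 'e \<times> 'e) chart" where
  "tangent_chart c = ({v \<in> tangent_bundle A. fst v \<in> fst c}, \<lambda>v. (snd c (fst v), snd v c))"

definition cotangent_chart :: "('m, 'e) chart \<Rightarrow> (('m, 'e) covec, 'e \<times> ('e \<Rightarrow>\<^sub>L real)) chart" where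
  "cotangent_chart c =
     ({\<zeta> \<in> cotangent_bundle A. fst \<zeta> \<in> fst c}, \<lambda>\<zeta>. (snd c (fst \<zeta>), covec_coord A c \<zeta>))"

lemma tangent_atlas_eq: "tangent_atlas A = tangent_chart ` A"
  unfolding tangent_atlas_def tangent_chart_def by (rule Setcompr_eq_image)

lemma cotangent_atlas_eq: "cotangent_atlas A = cotangent_chart ` A"
  unfolding cotangent_atlas_def cotangent_chart_def by (rule Setcompr_eq_image)

lemma manifold_of_tangent_atlas: "manifold_of (tangent_atlas A) = tangent_bundle A"
proof (rule Set.set_eqI)
  fix v
  have "\<exists>c\<in>A. fst v \<in> fst c" if "v \<in> tangent_bundle A"
    using tangent_space_base that unfolding tangent_bundle_iff manifold_of_def by blast
  then show "v \<in> manifold_of (tangent_atlas A) \<longleftrightarrow> v \<in> tangent_bundle A"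
    unfolding manifold_of_def tangent_atlas_eq tangent_chart_def by simp blast
qed

lemma manifold_of_cotangent_atlas: "manifold_of (cotangent_atlas A) = cotangent_bundle A"
proof (rule Set.set_eqI)
  fix \<zeta>
  have "\<exists>c\<in>A. fst \<zeta> \<in> fst c" if "\<zeta> \<in> cotangent_bundle A"
    using that unfolding cotangent_bundle_iff manifold_of_def by blast
  then show "\<zeta> \<in> manifold_of (cotangent_atlas A) \<longleftrightarrow> \<zeta> \<in> cotangent_bundle A"
    unfolding manifold_of_def cotangent_atlas_eq cotangent_chart_def by simp blast
qed

lemma manifold_of_cotangent_space_atlas:
  assumes "x \<in> manifold_of A"
  shows "manifold_of (cotangent_space_atlas A x) = cotangent_space A x"
proof -
  have "cotangent_space_atlas A x \<noteq> {}"
    using chart_at[OF assms] unfolding cotangent_space_atlas_def by blast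
  moreover have "fst C = cotangent_space A x" if "C \<in> cotangent_space_atlas A x" for C
    using that unfolding cotangent_space_atlas_def by force
  ultimately show ?thesis
    unfolding manifold_of_def by simp
qed

lemma chart_inv_tangent_chart:
  assumes "c \<in> A" "x \<in> fst c"
  shows "chart_inv (tangent_chart c) (snd c x, u) = tvec_of A c x u"
  unfolding chart_inv_def
proof (rule inv_into_f_eq)
  show "inj_on (snd (tangent_chart c)) (fst (tangent_chart c))"
  proof (rule inj_onI)
    fix v w
    assume "v \<in> fst (tangent_chart c)" "w \<in> fst (tangent_chart c)"
      "snd (tangent_chart c) v = snd (tangent_chart c) w"
    then have vw: "v \<in> tangent_space A (fst v)" "w \<in> tangent_space A (fst w)"
      "fst v \<in> fst c" "fst w \<in> fst c" "snd c (fst v) = snd c (fst w)" "snd v c = snd w c"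
      by (auto simp: tangent_chart_def tangent_bundle_iff)
    then have "fst v = fst w"
      using chart_inj[OF assms(1)] by (simp add: inj_on_eq_iff)
    then show "v = w"
      using vw assms(1) tangent_space_eqI by metis
  qed
  show "tvec_of A c x u \<in> fst (tangent_chart c)"
    using tangent_space_bundle[OF tvec_of(1)[OF assms]] tangent_space_fst[OF tvec_of(1)[OF assms]] assms
    by (simp add: tangent_chart_def)
  show "snd (tangent_chart c) (tvec_of A c x u) = (snd c x, u)"
    using tvec_of(2)[OF assms] tangent_space_fst[OF tvec_of(1)[OF assms]]
    by (simp add: tangent_chart_def)
qed

lemma chart_inv_cotangent_chart:
  assumes "c \<in> A" "x \<in> fst c"
  shows "chart_inv (cotangent_chart c) (snd c x, l) = covec_of c x l"
  unfolding chart_inv_def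
proof (rule inv_into_f_eq)
  show "inj_on (snd (cotangent_chart c)) (fst (cotangent_chart c))"
  proof (rule inj_onI)
    fix \<zeta> \<eta>
    assume "\<zeta> \<in> fst (cotangent_chart c)" "\<eta> \<in> fst (cotangent_chart c)"
      "snd (cotangent_chart c) \<zeta> = snd (cotangent_chart c) \<eta>"
    then have *: "\<zeta> \<in> cotangent_space A (fst \<zeta>)" "\<eta> \<in> cotangent_space A (fst \<eta>)"
      "fst \<zeta> \<in> fst c" "fst \<eta> \<in> fst c" "snd c (fst \<zeta>) = snd c (fst \<eta>)"
      "covec_coord A c \<zeta> = covec_coord A c \<eta>"
      by (auto simp: cotangent_chart_def cotangent_bundle_iff)
    then have "fst \<zeta> = fst \<eta>"
      using chart_inj[OF assms(1)] by (simp add: inj_on_eq_iff)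
    then show "\<zeta> = \<eta>"
      using * assms(1) covec_of_covec_coord by metis
  qed
  show "covec_of c x l \<in> fst (cotangent_chart c)"
    using assms covec_of_space[of c x l]
    by (auto simp: cotangent_chart_def cotangent_bundle_iff manifold_ofI)
  show "snd (cotangent_chart c) (covec_of c x l) = (snd c x, l)"
    using assms by (simp add: cotangent_chart_def covec_coord_covec_of)
qed

lemma chart_inv_cotangent_space_chart:
  assumes "c \<in> A" "x \<in> fst c"
  shows "chart_inv (cotangent_space A x, covec_coord A c) l = covec_of c x l"
  unfolding chart_inv_def
proof (rule inv_into_f_eq)
  show "inj_on (snd (cotangent_space A x, covec_coord A c)) (fst (cotangent_space A x, covec_coord A c))"
    by (rule inj_onI) (metis assms covec_of_covec_coord fst_conv snd_conv)
qed (use assms in \<open>auto simp: covec_of_space covec_coord_covec_of\<close>)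

subsection \<open>Functions on a fibre\<close>

text \<open>In the bundle chart and the fibre chart built from the same \<open>c\<close>, the
  inclusion of the fibre is the affine map sending l to (\<open>snd c x\<close>, l). This
  \<open>c\<close> is the one that smoothness of \<open>H\<close> supplies at \<open>p\<close>, and
  the atlas of the fibre has a chart for every such \<open>c\<close>.\<close>

lemma smooth_map_cotangent_fibre:
  assumes "smooth_map (cotangent_atlas A) real_atlas H" "x \<in> manifold_of A"
  shows "smooth_map (cotangent_space_atlas A x) real_atlas H"
  unfolding smooth_map_def
proof
  fix p assume "p \<in> manifold_of (cotangent_space_atlas A x)"
  then have p: "p \<in> cotangent_space A x"
    using manifold_of_cotangent_space_atlas assms(2) by simp
  then have "p \<in> manifold_of (cotangent_atlas A)"
    unfolding manifold_of_cotangent_atlas cotangent_bundle_def using assms(2) by blast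
  then obtain c e W where c: "c \<in> A" and e: "e \<in> real_atlas"
    and W: "p \<in> fst (cotangent_chart c)" "open W" "snd (cotangent_chart c) p \<in> W"
    "smooth_on W (snd e \<circ> H \<circ> chart_inv (cotangent_chart c))"
    using assms(1) unfolding smooth_map_def cotangent_atlas_eq by blast
  have x: "x \<in> fst c"
    using W(1) cotangent_space_fst[OF p] by (simp add: cotangent_chart_def)
  let ?K = "(cotangent_space A x, covec_coord A c)"
  let ?a = "\<lambda>l :: 'e \<Rightarrow>\<^sub>L real. (snd c x, 0) + (0, l)"
  have lin: "bounded_linear (\<lambda>l :: 'e \<Rightarrow>\<^sub>L real. (0 :: 'e, l))"
    by (intro bounded_linear_Pair bounded_linear_zero bounded_linear_ident)
  note sm = smooth_on_affine_linear[OF W(2) lin bounded_linear_ident W(4), of "(snd c x, 0)"]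
  have "smooth_on (?a -` W) (snd e \<circ> H \<circ> chart_inv ?K)"
    by (rule smooth_on_cong[OF sm(1) _ sm(2)])
      (simp add: chart_inv_cotangent_space_chart[OF c x] chart_inv_cotangent_chart[OF c x])
  moreover have "covec_coord A c p \<in> ?a -` W"
    using W(3) cotangent_space_fst[OF p] by (simp add: cotangent_chart_def)
  moreover have "?a -` W \<subseteq> snd ?K ` fst ?K"
    using covec_coord_covec_of[OF c x] covec_of_space[of c x] by (metis fst_conv image_eqI snd_conv subsetI)
  moreover have "?K \<in> cotangent_space_atlas A x"
    using c x unfolding cotangent_space_atlas_def by blast
  moreover have "H ` chart_inv ?K ` (?a -` W) \<subseteq> fst e"
    using e by (simp add: real_atlas_def)
  ultimately show "\<exists>c\<in>cotangent_space_atlas A x. \<exists>d\<in>real_atlas. \<exists>W. p \<in> fst c \<and> open W \<and>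
      snd c p \<in> W \<and> W \<subseteq> snd c ` fst c \<and> H ` chart_inv c ` W \<subseteq> fst d \<and>
      smooth_on W (snd d \<circ> H \<circ> chart_inv c)"
    using p e sm(1) by (intro bexI[of _ ?K] bexI[of _ e] exI[of _ "?a -` W"]) auto
qed

text \<open>Smoothness of \<open>L\<close> is given in the bundle chart of some \<open>d\<close>,
  which may differ from \<open>c\<close>. On the fibre the two coordinates are related by the linear
  map \<open>transition c d x\<close>, and for a first derivative the ordinary chain rule
  applies.\<close>

lemma differentiable_tangent_fibre:
  assumes "smooth_map (tangent_atlas A) real_atlas L" "c \<in> A" "x \<in> fst c"
  shows "(L \<circ> tvec_of A c x) differentiable (at u)"
proof -
  let ?v = "tvec_of A c x u"
  have v: "?v \<in> tangent_space A x" using tvec_of assms by blast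
  then have "?v \<in> manifold_of (tangent_atlas A)"
    unfolding manifold_of_tangent_atlas by (rule tangent_space_bundle)
  then obtain d e W where d: "d \<in> A" and e: "e \<in> real_atlas"
    and W: "?v \<in> fst (tangent_chart d)" "snd (tangent_chart d) ?v \<in> W"
    "smooth_on W (snd e \<circ> L \<circ> chart_inv (tangent_chart d))"
    using assms(1) unfolding smooth_map_def tangent_atlas_eq by blast
  have x: "x \<in> fst d"
    using W(1) tangent_space_fst[OF v] by (simp add: tangent_chart_def)
  have "snd (tangent_chart d) ?v = (snd d x, transition c d x u)"
    using tangent_space_fst[OF v] tangent_space_transition[OF v assms(2) d assms(3) x]
      tvec_of(2)[OF assms(2,3)] by (simp add: tangent_chart_def)
  then have "(L \<circ> chart_inv (tangent_chart d)) differentiable (at (snd d x, transition c d x u))"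
    using smooth_on_differentiable[OF W(3,2)] e by (simp add: real_atlas_def)
  moreover have "(\<lambda>u. (snd d x, transition c d x u)) differentiable (at u)"
    unfolding differentiable_def
    using has_derivative_Pair[OF has_derivative_const
      bounded_linear_imp_has_derivative[OF bounded_linear_transition[OF assms(2) d assms(3) x]]]
    by blast
  ultimately have "(\<lambda>u. (L \<circ> chart_inv (tangent_chart d)) (snd d x, transition c d x u))
      differentiable (at u)"
    by (rule differentiable_compose[where f = "L \<circ> chart_inv (tangent_chart d)"
          and g = "\<lambda>u. (snd d x, transition c d x u)"])
  moreover have "(\<lambda>u. (L \<circ> chart_inv (tangent_chart d)) (snd d x, transition c d x u))
      = L \<circ> tvec_of A c x"
    by (rule ext) (simp add: chart_inv_tangent_chart[OF d x] tvec_of_transition assms d x)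
  ultimately show ?thesis by simp
qed

text \<open>Components of vectors go from \<open>c\<close> to \<open>d\<close> by the transition
  map, so components of forms go back from \<open>d\<close> to \<open>c\<close> by its
  transpose.\<close>

lemma covec_of_transition:
  assumes "c \<in> A" "d \<in> A" "x \<in> fst c" "x \<in> fst d"
  shows "covec_of d x l = covec_of c x (l o\<^sub>L Blinfun (transition c d x))"
proof (rule cotangent_space_eqI[OF covec_of_space covec_of_space])
  fix v assume v: "v \<in> tangent_space A x"
  show "snd (covec_of d x l) v = snd (covec_of c x (l o\<^sub>L Blinfun (transition c d x))) v"
    using v tangent_space_transition[OF v assms] bounded_linear_transition[OF assms]
    by (simp add: snd_covec_of bounded_linear_Blinfun_apply)
qed

subsection \<open>The Legendre transformation on a fibre\<close>

abbreviation legendre_inv :: "(('m, 'e) tvec \<Rightarrow> real) \<Rightarrow> ('m, 'e) covec \<Rightarrow> ('m, 'e) tvec" where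
  "legendre_inv L \<equiv> inv_into (tangent_bundle A) (legendre A L)"

lemma fst_legendre [simp]: "fst (legendre A L v) = fst v"
  by (simp add: legendre_def)

lemma legendre_apply:
  assumes "v \<in> tangent_space A x" "w \<in> tangent_space A x"
  shows "snd (legendre A L v) w =
    frechet_derivative (L \<circ> tvec_of A (chart_at A x) x) (at (snd v (chart_at A x)))
      (snd w (chart_at A x))"
  using assms by (simp add: legendre_def tangent_space_fst Let_def)

lemma hyperregular_bij:
  "hyperregular A L \<Longrightarrow> bij_betw (legendre A L) (tangent_bundle A) (cotangent_bundle A)"
  unfolding hyperregular_def diffeomorphism_def
  by (simp add: manifold_of_tangent_atlas manifold_of_cotangent_atlas)

text \<open>That the fibre derivative is a linear form is part of hyperregularity, which makes the
  Legendre map a bijection onto the cotangent bundle; the base point is kept by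
  construction.\<close>

lemma legendre_space:
  assumes "hyperregular A L" "v \<in> tangent_space A x"
  shows "legendre A L v \<in> cotangent_space A x"
proof -
  have "legendre A L v \<in> cotangent_bundle A"
    using bij_betwE[OF hyperregular_bij[OF assms(1)]] tangent_space_bundle[OF assms(2)] by blast
  then show ?thesis
    using tangent_space_fst[OF assms(2)] by (simp add: cotangent_bundle_iff)
qed

lemma legendre_inv_legendre:
  assumes "hyperregular A L" "v \<in> tangent_space A x"
  shows "legendre_inv L (legendre A L v) = v"
  using bij_betw_inv_into_left[OF hyperregular_bij[OF assms(1)] tangent_space_bundle[OF assms(2)]] .

lemma legendre_inv:
  assumes "hyperregular A L" "x \<in> manifold_of A" "\<xi> \<in> cotangent_space A x"
  shows "legendre_inv L \<xi> \<in> tangent_space A x" "legendre A L (legendre_inv L \<xi>) = \<xi>"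
proof -
  have \<xi>: "\<xi> \<in> cotangent_bundle A"
    using assms(2,3) by (auto simp: cotangent_bundle_def)
  show eq: "legendre A L (legendre_inv L \<xi>) = \<xi>"
    using bij_betw_inv_into_right[OF hyperregular_bij[OF assms(1)] \<xi>] .
  have "legendre_inv L \<xi> \<in> tangent_bundle A"
    using bij_betwE[OF bij_betw_inv_into[OF hyperregular_bij[OF assms(1)]]] \<xi> by blast
  moreover have "fst (legendre_inv L \<xi>) = x"
    using arg_cong[OF eq, of fst] cotangent_space_fst[OF assms(3)] by simp
  ultimately show "legendre_inv L \<xi> \<in> tangent_space A x"
    by (simp add: tangent_space_def)
qed

lemma hamiltonian_of_legendre:
  assumes "hyperregular A L" "v \<in> tangent_space A x"
  shows "hamiltonian_of A L (legendre A L v) = snd (legendre A L v) v - L v"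
  using legendre_inv_legendre[OF assms] by (simp add: hamiltonian_of_def)

text \<open>Smoothness of the inverse Legendre map comes in charts \<open>d\<close> and
  \<open>e\<close> that depend on the covector, hence only a neighbourhood of \<open>l\<close>.
  Along the fibre both corrections are linear: the transpose of \<open>transition d c x\<close>
  before the map and \<open>transition e c x\<close> after it.\<close>

lemma legendre_inv_smooth_fibre:
  assumes "hyperregular A L" "c \<in> A" "x \<in> fst c"
  shows "\<exists>W. open W \<and> l \<in> W \<and> smooth_on W (\<lambda>l. snd (legendre_inv L (covec_of c x l)) c)"
proof -
  let ?\<xi> = "covec_of c x l"
  have M: "x \<in> manifold_of A" using assms manifold_ofI by blast
  then have "?\<xi> \<in> manifold_of (cotangent_atlas A)"
    unfolding manifold_of_cotangent_atlas cotangent_bundle_def using covec_of_space by blast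
  moreover have "smooth_map (cotangent_atlas A) (tangent_atlas A) (legendre_inv L)"
    using assms(1) unfolding hyperregular_def diffeomorphism_def manifold_of_tangent_atlas by blast
  ultimately obtain d e W where d: "d \<in> A" and e: "e \<in> A"
    and W: "?\<xi> \<in> fst (cotangent_chart d)" "open W" "snd (cotangent_chart d) ?\<xi> \<in> W"
    "legendre_inv L ` chart_inv (cotangent_chart d) ` W \<subseteq> fst (tangent_chart e)"
    "smooth_on W (snd (tangent_chart e) \<circ> legendre_inv L \<circ> chart_inv (cotangent_chart d))"
    unfolding smooth_map_def cotangent_atlas_eq tangent_atlas_eq by blast
  have xd: "x \<in> fst d"
    using W(1) by (simp add: cotangent_chart_def)
  define P where "P = Blinfun (transition d c x)"
  have cov: "covec_of c x l = covec_of d x (l o\<^sub>L P)" for l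
    unfolding P_def using covec_of_transition d assms(2,3) xd by blast
  have ch: "snd (cotangent_chart d) ?\<xi> = (snd d x, l o\<^sub>L P)"
    unfolding cov using covec_coord_covec_of[OF d xd] by (simp add: cotangent_chart_def)
  \<comment> \<open>The covector itself has its coordinates in \<open>W\<close>, so its image under
    the inverse Legendre map lies in the bundle chart of \<open>e\<close>. This puts
    \<open>x\<close> in \<open>fst e\<close>, and then the whole fibre is covered.\<close>
  have "legendre_inv L ?\<xi> \<in> fst (tangent_chart e)"
    using W(3,4) unfolding ch by (force simp: chart_inv_cotangent_chart[OF d xd] cov)
  then have xe: "x \<in> fst e"
    using tangent_space_fst[OF legendre_inv(1)[OF assms(1) M covec_of_space]]
    by (simp add: tangent_chart_def)
  have lin: "bounded_linear (\<lambda>l :: 'e \<Rightarrow>\<^sub>L real. (0 :: 'e, l o\<^sub>L P))"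
    by (intro bounded_linear_Pair bounded_linear_zero
        bounded_bilinear.bounded_linear_left[OF bounded_bilinear_blinfun_compose])
  have lin': "bounded_linear (\<lambda>z :: 'e \<times> 'e. transition e c x (snd z))"
    using bounded_linear_compose[OF bounded_linear_transition[OF e assms(2) xe assms(3)] bounded_linear_snd] .
  note sm = smooth_on_affine_linear[OF W(2) lin lin' W(5), of "(snd d x, 0)"]
  have "smooth_on ((\<lambda>l. (snd d x, 0) + (0, l o\<^sub>L P)) -` W)
      (\<lambda>l. snd (legendre_inv L (covec_of c x l)) c)"
  proof (rule smooth_on_cong[OF sm(1) _ sm(2)])
    fix l
    have "snd (legendre_inv L (covec_of c x l)) c
        = transition e c x (snd (legendre_inv L (covec_of c x l)) e)"
      using legendre_inv(1)[OF assms(1) M covec_of_space] e assms(2) xe assms(3)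
      by (rule tangent_space_transition)
    then show "transition e c x (snd ((snd (tangent_chart e) \<circ> legendre_inv L \<circ>
        chart_inv (cotangent_chart d)) ((snd d x, 0) + (0, l o\<^sub>L P))))
        = snd (legendre_inv L (covec_of c x l)) c"
      by (simp add: chart_inv_cotangent_chart[OF d xd] cov[symmetric] tangent_chart_def)
  qed
  moreover have "l \<in> (\<lambda>l. (snd d x, 0) + (0, l o\<^sub>L P)) -` W"
    using W(3) unfolding ch by simp
  ultimately show ?thesis using sm(1) by blast
qed

text \<open>
  In \<open>H(\<xi>) = \<langle>\<xi>, v(\<xi>)\<rangle> - L(v(\<xi>))\<close> with \<open>v = \<L>\<^sup>-\<^sup>1\<close>, the two terms containing the derivative of \<open>v\<close>
  cancel because \<open>\<xi>\<close> is the fibre derivative of \<open>L\<close> at \<open>v(\<xi>)\<close>.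
\<close>

lemma hamiltonian_of_has_derivative_fibre:
  fixes L x
  defines "c \<equiv> chart_at A x"
  assumes "smooth_map (tangent_atlas A) real_atlas L" "hyperregular A L" "x \<in> manifold_of A"
  shows "((\<lambda>l. hamiltonian_of A L (covec_of c x l)) has_derivative
    (\<lambda>k. blinfun_apply k (snd (legendre_inv L (covec_of c x l)) c))) (at l)"
proof -
  have c: "c \<in> A" "x \<in> fst c"
    using chart_at[OF assms(4)] by (auto simp: c_def)
  define \<nu> where "\<nu> l = snd (legendre_inv L (covec_of c x l)) c" for l
  let ?\<l> = "L \<circ> tvec_of A c x"
  have inv: "legendre_inv L (covec_of c x l) \<in> tangent_space A x"
    "legendre A L (legendre_inv L (covec_of c x l)) = covec_of c x l" for l
    using legendre_inv[OF assms(3,4) covec_of_space] .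
  have inv_eq: "tvec_of A c x (\<nu> l) = legendre_inv L (covec_of c x l)" for l
    unfolding \<nu>_def using tvec_of_eqI[OF c inv(1)] by blast
  have H: "hamiltonian_of A L (covec_of c x l) = blinfun_apply l (\<nu> l) - ?\<l> (\<nu> l)" for l
    by (simp add: hamiltonian_of_def Let_def snd_covec_of inv(1) inv_eq) (simp add: \<nu>_def)
  obtain N where N: "(\<nu> has_derivative N) (at l)"
    using legendre_inv_smooth_fibre[OF assms(3) c, of l] smooth_on_differentiable
    unfolding \<nu>_def differentiable_def by blast
  have D\<l>: "(?\<l> has_derivative frechet_derivative ?\<l> (at (\<nu> l))) (at (\<nu> l))"
    using differentiable_tangent_fibre[OF assms(2) c] by (simp add: frechet_derivative_works)
  \<comment> \<open>The choice of \<open>c\<close> as \<open>chart_at A x\<close> pays here: the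
    Legendre map is defined in that chart, so the fibre derivative of \<open>L\<close> at
    \<open>\<nu> l\<close> is \<open>l\<close> without any change of coordinates.\<close>
  have "frechet_derivative ?\<l> (at (\<nu> l)) u = blinfun_apply l u" for u
    using legendre_apply[OF inv(1) tvec_of(1)[OF c], of L l u] tvec_of[OF c]
    by (simp add: inv(2) snd_covec_of \<nu>_def flip: c_def)
  then have "((\<lambda>l. ?\<l> (\<nu> l)) has_derivative (\<lambda>k. blinfun_apply l (N k))) (at l)"
    using diff_chain_at[OF N D\<l>] by (simp add: o_def)
  moreover have "((\<lambda>l. blinfun_apply l (\<nu> l)) has_derivative
      (\<lambda>k. blinfun_apply l (N k) + blinfun_apply k (\<nu> l))) (at l)"
    using bounded_bilinear.FDERIV[OF bounded_bilinear_blinfun_apply has_derivative_ident N] .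
  ultimately have "((\<lambda>l. blinfun_apply l (\<nu> l) - ?\<l> (\<nu> l)) has_derivative
      (\<lambda>k. blinfun_apply l (N k) + blinfun_apply k (\<nu> l) - blinfun_apply l (N k))) (at l)"
    by (intro has_derivative_diff)
  then show ?thesis
    unfolding H by (simp add: \<nu>_def)
qed

text \<open>The derivative of H in direction v is l -> v(nu(l)), a fixed linear form after the
  inverse Legendre map nu, so nu of class C^k gives H of class C^(k+1). One neighbourhood on which
  nu is smooth serves all orders at once.\<close>

lemma hamiltonian_of_smooth_fibre:
  assumes "smooth_map (tangent_atlas A) real_atlas L" "hyperregular A L" "x \<in> manifold_of A"
  shows "smooth_map (cotangent_space_atlas A x) real_atlas (hamiltonian_of A L)"
  unfolding smooth_map_def
proof
  fix p assume "p \<in> manifold_of (cotangent_space_atlas A x)"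
  then have p: "p \<in> cotangent_space A x"
    using manifold_of_cotangent_space_atlas assms(3) by simp
  define c where "c = chart_at A x"
  have c: "c \<in> A" "x \<in> fst c"
    using chart_at[OF assms(3)] by (auto simp: c_def)
  let ?H = "\<lambda>l. hamiltonian_of A L (covec_of c x l)"
  let ?\<nu> = "\<lambda>l. snd (legendre_inv L (covec_of c x l)) c"
  let ?K = "(cotangent_space A x, covec_coord A c)"
  obtain W where W: "open W" "covec_coord A c p \<in> W" "smooth_on W ?\<nu>"
    using legendre_inv_smooth_fibre[OF assms(2) c] by blast
  have D: "(?H has_derivative (\<lambda>k. blinfun_apply k (?\<nu> l))) (at l)" for l
    using hamiltonian_of_has_derivative_fibre[OF assms] unfolding c_def .
  have Ck: "Ck_on (Suc k) W ?H" for k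
  proof -
    have "Ck_on k W (\<lambda>l. frechet_derivative ?H (at l) v)" for v
    proof (rule Ck_on_cong[OF W(1)])
      show "Ck_on k W (\<lambda>l. blinfun_apply v (?\<nu> l))"
        using W(3) Ck_on_bounded_linear[OF W(1) blinfun.bounded_linear_right]
        unfolding smooth_on_def by blast
      show "blinfun_apply v (?\<nu> l) = frechet_derivative ?H (at l) v" for l
        using fun_cong[OF frechet_derivative_at[OF D]] .
    qed
    moreover have "?H differentiable (at l)" for l
      using D unfolding differentiable_def by blast
    ultimately show ?thesis by simp
  qed
  have "continuous_on W ?H"
    by (intro continuous_at_imp_continuous_on ballI has_derivative_continuous[OF D])
  \<comment> \<open>\<open>Ck\<close> covers the positive orders; order 0 is the continuity just
    shown.\<close>
  then have "Ck_on k W ?H" for k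
    using Ck by (cases k) auto
  then have "smooth_on W (id \<circ> hamiltonian_of A L \<circ> chart_inv ?K)"
    by (simp add: smooth_on_def o_def chart_inv_cotangent_space_chart[OF c])
  moreover have "W \<subseteq> snd ?K ` fst ?K"
    using covec_coord_covec_of[OF c] covec_of_space[of c x] by (metis fst_conv image_eqI snd_conv subsetI)
  moreover have "?K \<in> cotangent_space_atlas A x"
    using c unfolding cotangent_space_atlas_def by blast
  ultimately show "\<exists>c\<in>cotangent_space_atlas A x. \<exists>d\<in>real_atlas. \<exists>W. p \<in> fst c \<and> open W \<and>
      snd c p \<in> W \<and> W \<subseteq> snd c ` fst c \<and> hamiltonian_of A L ` chart_inv c ` W \<subseteq> fst d \<and>
      smooth_on W (snd d \<circ> hamiltonian_of A L \<circ> chart_inv c)"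
    using p W(1,2) by (intro bexI[of _ ?K] bexI[of _ "(UNIV, id)"] exI[of _ W])
      (auto simp: real_atlas_def)
qed

end

section \<open>Right translations and the momentum map\<close>

context lie_group
begin

sublocale finite_dim_manifold X A
  using finite_dim atlas by unfold_locales

lemma manifold_of_eq: "manifold_of A = carrier G"
  using atlas topspace_eq unfolding smooth_atlas_def manifold_of_def by blast

text \<open>Right translation is multiplication restricted to the slice with second factor
  \<open>g\<close>, and in a product chart this slice is affine.\<close>

lemma smooth_right_translation:
  assumes g: "g \<in> carrier G"
  shows "smooth_map A A (\<lambda>x. x \<otimes> g)"
  unfolding smooth_map_def
proof
  fix p assume p: "p \<in> manifold_of A"
  let ?c0 = "(fst (chart_at A p) \<times> fst (chart_at A g), map_prod (snd (chart_at A p)) (snd (chart_at A g)))"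
  have "?c0 \<in> product_atlas A A" "(p, g) \<in> fst ?c0"
    using chart_at[OF p] chart_at[of g] g unfolding product_atlas_def manifold_of_eq by (blast, simp)
  then have "(p, g) \<in> manifold_of (product_atlas A A)"
    unfolding manifold_of_def by blast
  with smooth_mult obtain C e W where C: "C \<in> product_atlas A A" and e: "e \<in> A"
    and W: "(p, g) \<in> fst C" "open W" "snd C (p, g) \<in> W" "W \<subseteq> snd C ` fst C"
      "(\<lambda>(x, y). x \<otimes> y) ` chart_inv C ` W \<subseteq> fst e"
      "smooth_on W (snd e \<circ> (\<lambda>(x, y). x \<otimes> y) \<circ> chart_inv C)"
    unfolding smooth_map_def by meson
  obtain c d where c: "c \<in> A" "p \<in> fst c" and d: "d \<in> A" "g \<in> fst d"
    and Ceq: "C = (fst c \<times> fst d, map_prod (snd c) (snd d))"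
    using product_atlasE[OF C W(1)] by (metis fst_conv snd_conv)
  \<comment> \<open>The slice of \<open>W\<close> at the coordinate of \<open>g\<close>, written as
    a sum to fit \<open>smooth_on_affine_linear\<close>.\<close>
  define V where "V = (\<lambda>y. (0, snd d g) + (y, 0)) -` W"
  have lin: "bounded_linear (\<lambda>y :: 'e. (y, 0 :: 'e))"
    by (intro bounded_linear_Pair bounded_linear_zero bounded_linear_ident)
  note sm = smooth_on_affine_linear[OF W(2) lin bounded_linear_ident W(6), of "(0, snd d g)", folded V_def]
  \<comment> \<open>Because \<open>W\<close> lies in the image of the product chart, a point of the
    slice has a genuine preimage there, and injectivity identifies it as a pair with second entry
    \<open>g\<close>.\<close>
  have V: "y \<in> snd c ` fst c" "chart_inv C ((0, snd d g) + (y, 0)) = (chart_inv c y, g)"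
    "chart_inv c y \<otimes> g \<in> fst e" if "y \<in> V" for y
  proof -
    have yW: "(y, snd d g) \<in> W" using that by (simp add: V_def)
    then show y: "y \<in> snd c ` fst c"
      using W(4) unfolding Ceq by auto
    then have "(chart_inv c y, g) \<in> fst C" "snd C (chart_inv c y, g) = (y, snd d g)"
      using d by (auto simp: Ceq chart_inv_def inv_into_into f_inv_into_f)
    moreover have "inj_on (snd C) (fst C)"
      using chart_inj[OF c(1)] chart_inj[OF d(1)] by (simp add: Ceq map_prod_inj_on)
    ultimately show eq: "chart_inv C ((0, snd d g) + (y, 0)) = (chart_inv c y, g)"
      by (simp add: chart_inv_def inv_into_f_eq)
    show "chart_inv c y \<otimes> g \<in> fst e"
      using W(5) yW eq by force
  qed
  have "smooth_on V (snd e \<circ> (\<lambda>x. x \<otimes> g) \<circ> chart_inv c)"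
    by (rule smooth_on_cong[OF sm(1) _ sm(2)]) (simp add: V(2) del: add_Pair)
  moreover have "snd c p \<in> V"
    using W(3) by (simp add: Ceq V_def)
  ultimately show "\<exists>c\<in>A. \<exists>d\<in>A. \<exists>W. p \<in> fst c \<and> open W \<and> snd c p \<in> W \<and> W \<subseteq> snd c ` fst c \<and>
      (\<lambda>x. x \<otimes> g) ` chart_inv c ` W \<subseteq> fst d \<and> smooth_on W (snd d \<circ> (\<lambda>x. x \<otimes> g) \<circ> chart_inv c)"
    using c e sm(1) V by (intro bexI[of _ c] bexI[of _ e] exI[of _ V]) auto
qed

section \<open>Tangent lifts of right translations\<close>

lemma mdifferentiable_right_translation:
  "x \<in> carrier G \<Longrightarrow> g \<in> carrier G \<Longrightarrow> mdifferentiable (\<lambda>x. x \<otimes> g) x"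
  using smooth_map_mdifferentiable smooth_right_translation manifold_of_eq by blast

lemma tangent_space_carrier: "v \<in> tangent_space A x \<Longrightarrow> x \<in> carrier G"
  using tangent_space_base manifold_of_eq by blast

lemma TR_space:
  assumes "v \<in> tangent_space A x" "g \<in> carrier G"
  shows "TR G A g v \<in> tangent_space A (x \<otimes> g)"
  unfolding TR_def
  using tangent_map_space[OF mdifferentiable_right_translation] assms tangent_space_carrier by blast

lemma TR_TR:
  assumes "v \<in> tangent_space A x" "g \<in> carrier G" "h \<in> carrier G"
  shows "TR G A h (TR G A g v) = TR G A (g \<otimes> h) v"
proof -
  have x: "x \<in> carrier G" using assms tangent_space_carrier by blast
  have "TR G A h (TR G A g v) = tangent_map A A ((\<lambda>y. y \<otimes> h) \<circ> (\<lambda>y. y \<otimes> g)) v"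
    unfolding TR_def
    using assms x by (intro tangent_map_compose mdifferentiable_right_translation) auto
  also have "\<dots> = TR G A (g \<otimes> h) v"
    unfolding TR_def
    by (rule tangent_map_cong[symmetric, OF mdifferentiable_right_translation])
      (use assms x in \<open>auto simp: manifold_of_eq m_assoc\<close>)
  finally show ?thesis .
qed

lemma TR_one:
  assumes "v \<in> tangent_space A x"
  shows "TR G A \<one> v = v"
proof -
  have "TR G A \<one> v = tangent_map A A id v"
    unfolding TR_def
    by (rule tangent_map_cong[OF mdifferentiable_right_translation])
      (use assms tangent_space_carrier in \<open>auto simp: manifold_of_eq\<close>)
  then show ?thesis using tangent_map_id[OF assms] by simp
qed

lemma TR_inv_space:
  assumes "v \<in> tangent_space A (x \<otimes> g)" "x \<in> carrier G" "g \<in> carrier G"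
  shows "TR G A (inv g) v \<in> tangent_space A x"
  using TR_space[OF assms(1), of "inv g"] assms by (simp add: m_assoc)

lemma TR_inv_TR: "v \<in> tangent_space A x \<Longrightarrow> g \<in> carrier G \<Longrightarrow> TR G A (inv g) (TR G A g v) = v"
  by (simp add: TR_TR TR_one)

lemma TR_TR_inv: "v \<in> tangent_space A x \<Longrightarrow> g \<in> carrier G \<Longrightarrow> TR G A g (TR G A (inv g) v) = v"
  by (simp add: TR_TR TR_one)

section \<open>The lifted action on covectors and the momentum map\<close>

lemma cotangent_right_action:
  assumes "\<zeta> \<in> cotangent_space A x" "x \<in> carrier G" "g \<in> carrier G"
  shows "cotangent_right_action G A \<zeta> g \<in> cotangent_space A (x \<otimes> g)"
    "v \<in> tangent_space A (x \<otimes> g) \<Longrightarrow>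
      snd (cotangent_right_action G A \<zeta> g) v = snd \<zeta> (TR G A (inv g) v)"
proof -
  have "x \<otimes> g \<otimes> inv g = x" using assms by (simp add: m_assoc)
  then show "cotangent_right_action G A \<zeta> g \<in> cotangent_space A (x \<otimes> g)"
    unfolding cotangent_right_action_def cotangent_space_fst[OF assms(1)]
    using assms by (intro transpose_map_space mdifferentiable_right_translation) simp_all
  show "snd (cotangent_right_action G A \<zeta> g) v = snd \<zeta> (TR G A (inv g) v)"
    if "v \<in> tangent_space A (x \<otimes> g)"
    using that unfolding cotangent_right_action_def cotangent_space_fst[OF assms(1)] TR_def
    by (rule snd_transpose_map)
qed

lemma cotangent_right_action_TR:
  assumes "\<zeta> \<in> cotangent_space A x" "v \<in> tangent_space A x" "g \<in> carrier G"
  shows "snd (cotangent_right_action G A \<zeta> g) (TR G A g v) = snd \<zeta> v"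
  using cotangent_right_action(2)[OF assms(1) _ assms(3) TR_space[OF assms(2,3)]]
    tangent_space_carrier[OF assms(2)] TR_inv_TR[OF assms(2,3)] by simp

lemma left_momentum:
  assumes "\<zeta> \<in> cotangent_space A x" "x \<in> carrier G"
  shows "left_momentum G A \<zeta> \<in> cotangent_space A \<one>"
    "v \<in> tangent_space A \<one> \<Longrightarrow> snd (left_momentum G A \<zeta>) v = snd \<zeta> (TR G A x v)"
proof -
  show "left_momentum G A \<zeta> \<in> cotangent_space A \<one>"
    unfolding left_momentum_def cotangent_space_fst[OF assms(1)]
    using assms by (intro transpose_map_space mdifferentiable_right_translation) simp_all
  show "snd (left_momentum G A \<zeta>) v = snd \<zeta> (TR G A x v)" if "v \<in> tangent_space A \<one>"
    using that unfolding left_momentum_def cotangent_space_fst[OF assms(1)] TR_def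
    by (rule snd_transpose_map)
qed

lemma left_momentum_eq_action:
  assumes "\<zeta> \<in> cotangent_space A x" "x \<in> carrier G"
  shows "left_momentum G A \<zeta> = cotangent_right_action G A \<zeta> (inv x)"
proof (rule cotangent_space_eqI[OF left_momentum(1)[OF assms]])
  have x: "x \<otimes> inv x = \<one>" "inv x \<in> carrier G" using assms by simp_all
  show "cotangent_right_action G A \<zeta> (inv x) \<in> cotangent_space A \<one>"
    using cotangent_right_action(1)[OF assms x(2)] x by simp
  show "snd (left_momentum G A \<zeta>) v = snd (cotangent_right_action G A \<zeta> (inv x)) v"
    if "v \<in> tangent_space A \<one>" for v
    using that cotangent_right_action(2)[OF assms x(2)] left_momentum(2)[OF assms that] x assms
    by simp
qed

text \<open>Trivialising from \<open>x \<otimes> g\<close> moves a vector at the identity by R_x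
  followed by R_g, and the factor R_g is cancelled by the action on the covector.\<close>

lemma left_momentum_invariant:
  assumes "\<zeta> \<in> cotangent_space A x" "x \<in> carrier G" "g \<in> carrier G"
  shows "left_momentum G A (cotangent_right_action G A \<zeta> g) = left_momentum G A \<zeta>"
proof (rule cotangent_space_eqI[OF _ left_momentum(1)[OF assms(1,2)]])
  note act = cotangent_right_action[OF assms]
  have xg: "x \<otimes> g \<in> carrier G" using assms by simp
  show "left_momentum G A (cotangent_right_action G A \<zeta> g) \<in> cotangent_space A \<one>"
    using left_momentum(1)[OF act(1) xg] .
  fix v assume v: "v \<in> tangent_space A \<one>"
  have vx: "TR G A x v \<in> tangent_space A x"
    using TR_space[OF v assms(2)] assms(2) by simp
  show "snd (left_momentum G A (cotangent_right_action G A \<zeta> g)) v = snd (left_momentum G A \<zeta>) v"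
    using left_momentum(2)[OF act(1) xg v] left_momentum(2)[OF assms(1,2) v]
      cotangent_right_action_TR[OF assms(1) vx assms(3)] TR_TR[OF v assms(2,3)] by simp
qed

section \<open>Invariant Hamiltonians and invariant Lagrangians\<close>

lemma cotangent_bundleE:
  assumes "\<zeta> \<in> cotangent_bundle A"
  obtains x where "x \<in> carrier G" "\<zeta> \<in> cotangent_space A x"
  using assms manifold_of_eq unfolding cotangent_bundle_def by blast

lemma cotangent_bundleI: "\<zeta> \<in> cotangent_space A x \<Longrightarrow> x \<in> carrier G \<Longrightarrow> \<zeta> \<in> cotangent_bundle A"
  using manifold_of_eq unfolding cotangent_bundle_def by blast

text \<open>Smoothness is assumed on the fibre over the identity alone, so that the lemma serves
  both an arbitrary smooth Hamiltonian and \<open>hamiltonian_of A L\<close>, whose smoothness is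
  proved along fibres. For h one takes \<open>H\<close> itself, since \<open>left_momentum\<close>
  lands in covectors at the identity.\<close>

lemma factors_iff_invariant:
  assumes "smooth_map (cotangent_space_atlas A \<one>) real_atlas H"
  shows "factors_through_momentum G A H \<longleftrightarrow>
    (\<forall>\<zeta>\<in>cotangent_bundle A. \<forall>g\<in>carrier G. H (cotangent_right_action G A \<zeta> g) = H \<zeta>)"
proof
  assume "factors_through_momentum G A H"
  then obtain h where h: "\<And>\<zeta>. \<zeta> \<in> cotangent_bundle A \<Longrightarrow> H \<zeta> = h (left_momentum G A \<zeta>)"
    unfolding factors_through_momentum_def by blast
  show "\<forall>\<zeta>\<in>cotangent_bundle A. \<forall>g\<in>carrier G. H (cotangent_right_action G A \<zeta> g) = H \<zeta>"
  proof (intro ballI)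
    fix \<zeta> g assume \<zeta>: "\<zeta> \<in> cotangent_bundle A" and g: "g \<in> carrier G"
    obtain x where x: "x \<in> carrier G" "\<zeta> \<in> cotangent_space A x"
      using \<zeta> by (rule cotangent_bundleE)
    have "cotangent_right_action G A \<zeta> g \<in> cotangent_bundle A"
      using cotangent_bundleI[OF cotangent_right_action(1)[OF x(2,1) g]] x g by simp
    then show "H (cotangent_right_action G A \<zeta> g) = H \<zeta>"
      using h \<zeta> left_momentum_invariant[OF x(2,1) g] by simp
  qed
next
  assume inv: "\<forall>\<zeta>\<in>cotangent_bundle A. \<forall>g\<in>carrier G. H (cotangent_right_action G A \<zeta> g) = H \<zeta>"
  have "H \<zeta> = H (left_momentum G A \<zeta>)" if \<zeta>: "\<zeta> \<in> cotangent_bundle A" for \<zeta>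
  proof -
    obtain x where x: "x \<in> carrier G" "\<zeta> \<in> cotangent_space A x"
      using \<zeta> by (rule cotangent_bundleE)
    \<comment> \<open>Invariance is applied at g = \<open>inv x\<close>, the element that moves
      \<open>\<zeta>\<close> to the identity.\<close>
    then show ?thesis
      using inv \<zeta> left_momentum_eq_action by simp
  qed
  then show "factors_through_momentum G A H"
    using assms unfolding factors_through_momentum_def by blast
qed

text \<open>The trivialisation turns R_g into right multiplication of the first factor, so every
  orbit is the image of G x {Y} for one Y in the Lie algebra, and a function is constant on orbits
  exactly when the first factor does not matter.\<close>

lemma lagrangian_invariant_iff:
  "(\<forall>Y\<in>lie_algebra_space G A. \<forall>x\<in>carrier G. \<forall>y\<in>carrier G.
      (L \<circ> right_triv G A) (x, Y) = (L \<circ> right_triv G A) (y, Y)) \<longleftrightarrow>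
   (\<forall>v\<in>tangent_bundle A. \<forall>g\<in>carrier G. L (tangent_right_action G A v g) = L v)"
  (is "?triv \<longleftrightarrow> ?inv")
proof
  assume ?triv
  have eq: "L (TR G A x Y) = L (TR G A y Y)"
    if "Y \<in> tangent_space A \<one>" "x \<in> carrier G" "y \<in> carrier G" for Y x y
  proof -
    have "(L \<circ> right_triv G A) (x, Y) = (L \<circ> right_triv G A) (y, Y)"
      using \<open>?triv\<close> that unfolding lie_algebra_space_def by blast
    then show ?thesis by (simp add: right_triv_def)
  qed
  show ?inv
  proof (intro ballI)
    fix v g assume "v \<in> tangent_bundle A" and g: "g \<in> carrier G"
    then obtain x where v: "v \<in> tangent_space A x" using tangent_bundle_iff by blast
    then have x: "x \<in> carrier G" by (rule tangent_space_carrier)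
    let ?Y = "TR G A (inv x) v"
    have Y: "?Y \<in> tangent_space A \<one>"
      using TR_space[OF v, of "inv x"] x by simp
    have "TR G A x ?Y = v"
      using TR_TR_inv[OF v x] .
    moreover from this have "TR G A (x \<otimes> g) ?Y = TR G A g v"
      using TR_TR[OF Y x g] by simp
    ultimately show "L (tangent_right_action G A v g) = L v"
      using eq[OF Y, of "x \<otimes> g" x] x g by (simp add: tangent_right_action_def)
  qed
next
  assume ?inv
  then show ?triv
    by (simp add: lie_algebra_space_def right_triv_def tangent_right_action_def tangent_space_bundle)
qed

section \<open>Equivariance of the Legendre map and of its inverse\<close>

lemma TR_chart_deriv:
  assumes "x \<in> carrier G" "g \<in> carrier G"
  obtains M where "bounded_linear M" "\<And>v. v \<in> tangent_space A x \<Longrightarrow>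
    snd (TR G A g v) (chart_at A (x \<otimes> g)) = M (snd v (chart_at A x))"
proof -
  have ch: "chart_at A x \<in> A" "x \<in> fst (chart_at A x)"
    "chart_at A (x \<otimes> g) \<in> A" "x \<otimes> g \<in> fst (chart_at A (x \<otimes> g))"
    using chart_at manifold_of_eq assms by simp_all
  obtain M where M: "chart_deriv (\<lambda>x. x \<otimes> g) (chart_at A x) (chart_at A (x \<otimes> g)) x M"
    using mdifferentiable_chart_deriv[OF mdifferentiable_right_translation[OF assms] ch(1,3,2,4)] .
  show ?thesis
    using that[OF chart_deriv_bounded_linear[OF M]] tangent_map_chart[OF M ch(1,3)]
    unfolding TR_def by blast
qed

text \<open>In coordinates R_g is a linear map M between the two fibres, so invariance of
  \<open>L\<close> says that its restriction to the fibre over \<open>x\<close> is its restriction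
  over \<open>x \<otimes> g\<close> composed with M. Differentiating this identity relates the two
  fibre derivatives by the transpose of M, which is the lifted action read on vectors R_g w.\<close>

lemma legendre_equivariant:
  assumes L: "smooth_map (tangent_atlas A) real_atlas L" "hyperregular A L"
    and inv: "\<And>v g. v \<in> tangent_bundle A \<Longrightarrow> g \<in> carrier G \<Longrightarrow> L (TR G A g v) = L v"
    and v: "v \<in> tangent_space A x" and g: "g \<in> carrier G"
  shows "legendre A L (TR G A g v) = cotangent_right_action G A (legendre A L v) g"
proof -
  have x: "x \<in> carrier G" using v by (rule tangent_space_carrier)
  let ?y = "x \<otimes> g"
  let ?c = "chart_at A x" and ?d = "chart_at A ?y"
  have ch: "?c \<in> A" "x \<in> fst ?c" "?d \<in> A" "?y \<in> fst ?d"
    using chart_at manifold_of_eq x g by simp_all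
  obtain M where M: "bounded_linear M"
    "\<And>v. v \<in> tangent_space A x \<Longrightarrow> snd (TR G A g v) ?d = M (snd v ?c)"
    using TR_chart_deriv[OF x g] by blast
  let ?l = "L \<circ> tvec_of A ?c x" and ?k = "L \<circ> tvec_of A ?d ?y"
  have lk: "?l = ?k \<circ> M"
  proof
    fix u
    have u: "tvec_of A ?c x u \<in> tangent_space A x" "snd (tvec_of A ?c x u) ?c = u"
      using tvec_of[OF ch(1,2)] by auto
    have "tvec_of A ?d ?y (M u) = TR G A g (tvec_of A ?c x u)"
      using tvec_of_eqI[OF ch(3,4) TR_space[OF u(1) g]] M(2)[OF u(1)] u(2) by simp
    then show "?l u = (?k \<circ> M) u"
      using inv[OF tangent_space_bundle[OF u(1)] g] by simp
  qed
  have deriv: "frechet_derivative ?l (at u) = frechet_derivative ?k (at (M u)) \<circ> M" for u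
  proof -
    have "(M has_derivative M) (at u)"
      using M(1) by (rule bounded_linear_imp_has_derivative)
    moreover have "(?k has_derivative frechet_derivative ?k (at (M u))) (at (M u))"
      using differentiable_tangent_fibre[OF L(1) ch(3,4)] by (simp add: frechet_derivative_works)
    ultimately show ?thesis
      unfolding lk by (intro frechet_derivative_at[symmetric] diff_chain_at)
  qed
  have leg: "legendre A L v \<in> cotangent_space A x"
    using legendre_space[OF L(2) v] .
  show ?thesis
  proof (rule cotangent_space_eqI)
    show "legendre A L (TR G A g v) \<in> cotangent_space A ?y"
      using legendre_space[OF L(2) TR_space[OF v g]] .
    show "cotangent_right_action G A (legendre A L v) g \<in> cotangent_space A ?y"
      using cotangent_right_action(1)[OF leg x g] .
    fix w assume w: "w \<in> tangent_space A ?y"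
    let ?w = "TR G A (inv g) w"
    have w': "?w \<in> tangent_space A x" "w = TR G A g ?w"
      using TR_inv_space[OF w x g] TR_TR_inv[OF w g] by auto
    have "snd (legendre A L (TR G A g v)) w = frechet_derivative ?k (at (M (snd v ?c))) (M (snd ?w ?c))"
      using legendre_apply[OF TR_space[OF v g] w] M(2)[OF v] M(2)[OF w'(1)] w'(2) by simp
    also have "\<dots> = snd (legendre A L v) ?w"
      using legendre_apply[OF v w'(1)] fun_cong[OF deriv] by simp
    also have "\<dots> = snd (cotangent_right_action G A (legendre A L v) g) w"
      using cotangent_right_action(2)[OF leg x g w] by simp
    finally show "snd (legendre A L (TR G A g v)) w
        = snd (cotangent_right_action G A (legendre A L v) g) w" .
  qed
qed

text \<open>Write the covector as the Legendre image of v. In <\<zeta>, v> - L(v) the pairing is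
  unchanged because vector and covector move together, and L(v) is unchanged by assumption.\<close>

lemma hamiltonian_of_invariant:
  assumes L: "smooth_map (tangent_atlas A) real_atlas L" "hyperregular A L"
    and inv: "\<And>v g. v \<in> tangent_bundle A \<Longrightarrow> g \<in> carrier G \<Longrightarrow> L (TR G A g v) = L v"
    and \<zeta>: "\<zeta> \<in> cotangent_bundle A" and g: "g \<in> carrier G"
  shows "hamiltonian_of A L (cotangent_right_action G A \<zeta> g) = hamiltonian_of A L \<zeta>"
proof -
  obtain x where x: "x \<in> carrier G" "\<zeta> \<in> cotangent_space A x"
    using \<zeta> by (rule cotangent_bundleE)
  define v where "v = legendre_inv L \<zeta>"
  have v: "v \<in> tangent_space A x" "legendre A L v = \<zeta>"
    unfolding v_def using legendre_inv[OF L(2) _ x(2)] x(1) manifold_of_eq by auto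
  have "legendre A L (TR G A g v) = cotangent_right_action G A \<zeta> g"
    using legendre_equivariant[OF L inv v(1) g] v(2) by simp
  then show ?thesis
    using hamiltonian_of_legendre[OF L(2) TR_space[OF v(1) g]] hamiltonian_of_legendre[OF L(2) v(1)]
      inv[OF tangent_space_bundle[OF v(1)] g] cotangent_right_action_TR[OF x(2) v(1) g] v(2) by simp
qed

text \<open>In coordinates the action on covectors is inverse to l -> l o M, so invariance says
  H_y(l) = H_x(l o M) on the fibres over x and y = xg. Since the fibre derivative of H is the
  inverse Legendre map, differentiating gives k(mu(l)) = k(M(nu(l o M))) for every form k.\<close>

lemma legendre_inv_equivariant:
  assumes L: "smooth_map (tangent_atlas A) real_atlas L" "hyperregular A L"
    and inv: "\<And>\<zeta> g. \<zeta> \<in> cotangent_bundle A \<Longrightarrow> g \<in> carrier G \<Longrightarrow>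
      hamiltonian_of A L (cotangent_right_action G A \<zeta> g) = hamiltonian_of A L \<zeta>"
    and \<xi>: "\<xi> \<in> cotangent_space A x" and x: "x \<in> carrier G" and g: "g \<in> carrier G"
  shows "legendre_inv L (cotangent_right_action G A \<xi> g) = TR G A g (legendre_inv L \<xi>)"
proof -
  let ?y = "x \<otimes> g"
  let ?c = "chart_at A x" and ?d = "chart_at A ?y"
  have ch: "?c \<in> A" "x \<in> fst ?c" "?d \<in> A" "?y \<in> fst ?d"
    and base: "x \<in> manifold_of A" "?y \<in> manifold_of A"
    using chart_at manifold_of_eq x g by simp_all
  obtain M where M: "bounded_linear M"
    "\<And>v. v \<in> tangent_space A x \<Longrightarrow> snd (TR G A g v) ?d = M (snd v ?c)"
    using TR_chart_deriv[OF x g] by blast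
  define P where "P = Blinfun M"
  have P: "blinfun_apply P = M"
    unfolding P_def by (rule bounded_linear_Blinfun_apply[OF M(1)])
  let ?\<nu> = "\<lambda>l. snd (legendre_inv L (covec_of ?c x l)) ?c"
  let ?\<mu> = "\<lambda>l. snd (legendre_inv L (covec_of ?d ?y l)) ?d"
  have cov: "covec_of ?d ?y l = cotangent_right_action G A (covec_of ?c x (l o\<^sub>L P)) g" for l
  proof (rule cotangent_space_eqI[OF covec_of_space cotangent_right_action(1)[OF covec_of_space x g]])
    fix w assume w: "w \<in> tangent_space A ?y"
    let ?w = "TR G A (inv g) w"
    have w': "?w \<in> tangent_space A x" "w = TR G A g ?w"
      using TR_inv_space[OF w x g] TR_TR_inv[OF w g] by auto
    then have "snd w ?d = M (snd ?w ?c)" using M(2) by metis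
    then show "snd (covec_of ?d ?y l) w = snd (cotangent_right_action G A (covec_of ?c x (l o\<^sub>L P)) g) w"
      unfolding cotangent_right_action(2)[OF covec_of_space x g w]
      by (simp add: snd_covec_of w w'(1) P)
  qed
  have H: "hamiltonian_of A L (covec_of ?d ?y l) = hamiltonian_of A L (covec_of ?c x (l o\<^sub>L P))" for l
    unfolding cov using inv[OF cotangent_bundleI[OF covec_of_space x] g] .
  have \<mu>: "?\<mu> l = M (?\<nu> (l o\<^sub>L P))" for l
  proof -
    have "((\<lambda>l. l o\<^sub>L P) has_derivative (\<lambda>l. l o\<^sub>L P)) (at l)"
      by (intro bounded_linear_imp_has_derivative
          bounded_bilinear.bounded_linear_left[OF bounded_bilinear_blinfun_compose])
    from diff_chain_at[OF this hamiltonian_of_has_derivative_fibre[OF L base(1)]]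
    have *: "((\<lambda>l. hamiltonian_of A L (covec_of ?d ?y l)) has_derivative
        (\<lambda>k. blinfun_apply k (M (?\<nu> (l o\<^sub>L P))))) (at l)"
      unfolding H by (simp add: o_def P)
    have k: "blinfun_apply k (?\<mu> l) = blinfun_apply k (M (?\<nu> (l o\<^sub>L P)))"
      for k :: "'e \<Rightarrow>\<^sub>L real"
      using fun_cong[OF has_derivative_unique[OF hamiltonian_of_has_derivative_fibre[OF L base(2)] *]] .
    \<comment> \<open>Forms separate points: testing with the inner product against the difference
      itself shows that the difference vanishes.\<close>
    let ?z = "?\<mu> l - M (?\<nu> (l o\<^sub>L P))"
    have "?\<mu> l \<bullet> ?z = M (?\<nu> (l o\<^sub>L P)) \<bullet> ?z"
      using k[of "Blinfun (\<lambda>u. u \<bullet> ?z)"]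
      by (simp add: bounded_linear_Blinfun_apply bounded_linear_inner_left)
    then have "?z \<bullet> ?z = 0" by (simp add: inner_diff_left)
    then show ?thesis by simp
  qed
  let ?\<eta> = "cotangent_right_action G A \<xi> g"
  define l where "l = covec_coord A ?d ?\<eta>"
  have \<eta>: "?\<eta> \<in> cotangent_space A ?y" "covec_of ?d ?y l = ?\<eta>"
    using cotangent_right_action(1)[OF \<xi> x g] covec_of_covec_coord[OF ch(3,4)] unfolding l_def by auto
  have \<xi>_eq: "covec_of ?c x (l o\<^sub>L P) = \<xi>"
  proof (rule cotangent_space_eqI[OF covec_of_space \<xi>])
    fix w assume w: "w \<in> tangent_space A x"
    have "snd \<xi> w = snd (covec_of ?d ?y l) (TR G A g w)"
      unfolding \<eta>(2) using cotangent_right_action_TR[OF \<xi> w g] by simp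
    then show "snd (covec_of ?c x (l o\<^sub>L P)) w = snd \<xi> w"
      by (simp add: snd_covec_of w TR_space[OF w g] M(2) P)
  qed
  show ?thesis
  proof (rule tangent_space_eqI[OF _ _ ch(3,4)])
    have v: "legendre_inv L \<xi> \<in> tangent_space A x"
      using legendre_inv(1)[OF L(2) base(1) \<xi>] .
    show "legendre_inv L ?\<eta> \<in> tangent_space A ?y"
      using legendre_inv(1)[OF L(2) base(2) \<eta>(1)] .
    show "TR G A g (legendre_inv L \<xi>) \<in> tangent_space A ?y"
      using TR_space[OF v g] .
    show "snd (legendre_inv L ?\<eta>) ?d = snd (TR G A g (legendre_inv L \<xi>)) ?d"
      using \<mu>[of l] M(2)[OF v] unfolding \<eta>(2) \<xi>_eq by simp
  qed
qed

text \<open>The Lagrangian is recovered as L(v) = <\<xi>, v> - H(\<xi>) with \<xi> the Legendre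
  image of v. By \<open>legendre_inv_equivariant\<close> the vector belonging to the moved covector
  is the moved vector, and the pairing is preserved.\<close>

lemma lagrangian_invariant:
  assumes L: "smooth_map (tangent_atlas A) real_atlas L" "hyperregular A L"
    and inv: "\<And>\<zeta> g. \<zeta> \<in> cotangent_bundle A \<Longrightarrow> g \<in> carrier G \<Longrightarrow>
      hamiltonian_of A L (cotangent_right_action G A \<zeta> g) = hamiltonian_of A L \<zeta>"
    and v: "v \<in> tangent_bundle A" and g: "g \<in> carrier G"
  shows "L (TR G A g v) = L v"
proof -
  obtain x where v: "v \<in> tangent_space A x"
    using v tangent_bundle_iff by blast
  then have x: "x \<in> carrier G" by (rule tangent_space_carrier)
  let ?\<xi> = "legendre A L v"
  have \<xi>: "?\<xi> \<in> cotangent_space A x" using legendre_space[OF L(2) v] .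
  have "legendre_inv L (cotangent_right_action G A ?\<xi> g) = TR G A g v"
    using legendre_inv_equivariant[OF L inv \<xi> x g] legendre_inv_legendre[OF L(2) v] by simp
  then have "hamiltonian_of A L (cotangent_right_action G A ?\<xi> g) = snd ?\<xi> v - L (TR G A g v)"
    using cotangent_right_action_TR[OF \<xi> v g] by (simp add: hamiltonian_of_def)
  then show ?thesis
    using inv[OF cotangent_bundleI[OF \<xi> x] g] hamiltonian_of_legendre[OF L(2) v] by simp
qed

lemma hamiltonian_factors_iff:
  assumes "smooth_map (tangent_atlas A) real_atlas L" "hyperregular A L"
  shows "factors_through_momentum G A (hamiltonian_of A L) \<longleftrightarrow>
    (\<forall>v\<in>tangent_bundle A. \<forall>g\<in>carrier G. L (tangent_right_action G A v g) = L v)"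
proof -
  have "factors_through_momentum G A (hamiltonian_of A L) \<longleftrightarrow>
    (\<forall>\<zeta>\<in>cotangent_bundle A. \<forall>g\<in>carrier G.
      hamiltonian_of A L (cotangent_right_action G A \<zeta> g) = hamiltonian_of A L \<zeta>)"
    using factors_iff_invariant[OF hamiltonian_of_smooth_fibre[OF assms]] manifold_of_eq by simp
  also have "\<dots> \<longleftrightarrow> (\<forall>v\<in>tangent_bundle A. \<forall>g\<in>carrier G. L (tangent_right_action G A v g) = L v)"
    unfolding tangent_right_action_def
    using lagrangian_invariant[OF assms] hamiltonian_of_invariant[OF assms] by blast
  finally show ?thesis .
qed

end

theorem proposition3:
  fixes G :: "('g, 'b) monoid_scheme" and X :: "'g topology"
    and A :: "('g, 'e::real_inner) chart set"
  assumes "lie_group G X A" and "connected_space X"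
  shows "(\<forall>H. smooth_map (cotangent_atlas A) real_atlas H \<longrightarrow>
            (factors_through_momentum G A H \<longleftrightarrow>
              (\<forall>\<zeta>\<in>cotangent_bundle A. \<forall>g\<in>carrier G. H (cotangent_right_action G A \<zeta> g) = H \<zeta>)))
       \<and> (\<forall>L. smooth_map (tangent_atlas A) real_atlas L \<and> hyperregular A L \<longrightarrow>
            (factors_through_momentum G A (hamiltonian_of A L) \<longleftrightarrow>
              (\<forall>Y\<in>lie_algebra_space G A. \<forall>x\<in>carrier G. \<forall>y\<in>carrier G.
                 (L \<circ> right_triv G A) (x, Y) = (L \<circ> right_triv G A) (y, Y))) \<and>
            (factors_through_momentum G A (hamiltonian_of A L) \<longleftrightarrow>
              (\<forall>v\<in>tangent_bundle A. \<forall>g\<in>carrier G. L (tangent_right_action G A v g) = L v)))"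
proof -
  interpret lie_group G X A by fact
  have one: "\<one>\<^bsub>G\<^esub> \<in> manifold_of A" by (simp add: manifold_of_eq)
  \<comment> \<open>Rewriting the condition on the trivialised Lagrangian as invariance makes the
    two equivalences for \<open>L\<close> coincide.\<close>
  show ?thesis
    unfolding lagrangian_invariant_iff
    using factors_iff_invariant[OF smooth_map_cotangent_fibre[OF _ one]] hamiltonian_factors_iff
    by (intro conjI allI impI) simp_all
qed

end
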